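(* Let $X_0\in\mathbb{R}^{n+1}$, $t_0>0$, $\lambda\in\mathbb{R}$, and let $X(s)$ be a variation of the immersed hypersurface $X:M\to\mathbb{R}^{n+1}$ with normal variation vector field $\frac{\partial X(s)}{\partial s}|_{s=0}=fN$. If $X_s$ and $t_s$ are variations of $X_0$ and $t_0$ with $\frac{\partial X_s}{\partial s}|_{s=0}=y$ and $\frac{\partial t_s}{\partial s}|_{s=0}=h$, then the first variation formula of $\mathcal{F}_{X_s,t_s}(s)$ is given by $$\begin{aligned}\mathcal{F}'_{X_0,t_0}(0)=&(4\pi t_0)^{-\frac n2}\int_M\Bigl(\lambda-\bigl(H+\langle\tfrac{X-X_0}{t_0},N\rangle\bigr)\Bigr)f\,e^{-\frac{|X-X_0|^2}{2t_0}}d\mu\\&+(4\pi t_0)^{-\frac n2}\int_M\Bigl(\langle\tfrac{X-X_0}{t_0},y\rangle-\lambda\langle N,y\rangle\Bigr)e^{-\frac{|X-X_0|^2}{2t_0}}d\mu\\&+(4\pi t_0)^{-\frac n2}\int_M\Bigl(\frac{|X-X_0|^2}{t_0}-n-\lambda\langle X-X_0,N\rangle\Bigr)\frac{h}{2t_0}e^{-\frac{|X-X_0|^2}{2t_0}}d\mu.\end{aligned}$$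
   Context: $N$ and $d\mu$ are the unit normal and area element of $X$; $H=\sum_i h_{ii}$ is the trace of $h_{ij}=-\langle D_{e_i}N,e_j\rangle$ in a local orthonormal tangent frame. Variations $X(s)$ of $X$ ($X(0)=X$) are compactly supported; $d\mu_s$ is the area element of $X(s)$; $X_s\in\mathbb{R}^{n+1}$ and $t_s>0$ are smooth in $s$ and equal $X_0,t_0$ at $s=0$. The $\mathcal{F}$-functional is $$\mathcal{F}_{X_s,t_s}(s)=(4\pi t_s)^{-\frac n2}\int_M e^{-\frac{|X(s)-X_s|^2}{2t_s}}d\mu_s+\lambda(4\pi t_0)^{-\frac n2}\Bigl(\frac{t_0}{t_s}\Bigr)^{\frac12}\int_M\langle X(s)-X_s,N\rangle e^{-\frac{|X-X_0|^2}{2t_0}}d\mu,$$ with $N,d\mu$ those of $X=X(0)$; the integrals involved are understood to be finite. $\mathcal{F}'_{X_0,t_0}(0)$ denotes its derivative in $s$ at $s=0$.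
   Formalization: Finiteness of the integrals is taken to mean that the Gaussian-weighted area of X is finite for all centres and scales in a neighbourhood of (X_0, t_0); finiteness only along the given X_s, t_s does not suffice for differentiability at s=0. *)

theory Defs
  imports "HOL-Analysis.Analysis"
begin

text \<open>\<open>C\<^sup>\<infinity>\<close> regularity; used for open \<open>S\<close> only, where the unrestricted filter \<open>at x\<close> is the
  appropriate one.\<close>

primrec Ck_on :: "nat \<Rightarrow> 'a::real_normed_vector set \<Rightarrow> ('a \<Rightarrow> 'b::real_normed_vector) \<Rightarrow> bool" where
  "Ck_on 0 S f \<longleftrightarrow> continuous_on S f"
| "Ck_on (Suc k) S f \<longleftrightarrow>
     (\<forall>x\<in>S. f differentiable (at x)) \<and> (\<forall>v. Ck_on k S (\<lambda>x. frechet_derivative f (at x) v))"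

definition smooth_on :: "'a::real_normed_vector set \<Rightarrow> ('a \<Rightarrow> 'b::real_normed_vector) \<Rightarrow> bool" where
  "smooth_on S f \<longleftrightarrow> (\<forall>k. Ck_on k S f)"

text \<open>A chart is a pair \<open>(U, \<phi>)\<close>; \<open>chart_inv\<close> is the local parametrization \<open>\<phi>\<^sup>-\<^sup>1\<close> on \<open>\<phi> ` U\<close>.\<close>

type_synonym ('a, 'n) chart = "'a set \<times> ('a \<Rightarrow> real ^ 'n)"

abbreviation chart_inv :: "('a, 'n::finite) chart \<Rightarrow> real ^ 'n \<Rightarrow> 'a" where
  "chart_inv c \<equiv> inv_into (fst c) (snd c)"

definition is_chart :: "'a topology \<Rightarrow> ('a, 'n::finite) chart \<Rightarrow> bool" where
  "is_chart M c \<longleftrightarrow> openin M (fst c) \<and> open (snd c ` fst c) \<and>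
     homeomorphic_map (subtopology M (fst c)) (top_of_set (snd c ` fst c)) (snd c)"

text \<open>The atlas need not be maximal.\<close>

definition smooth_manifold :: "'a topology \<Rightarrow> ('a, 'n::finite) chart set \<Rightarrow> bool" where
  "smooth_manifold M A \<longleftrightarrow> Hausdorff_space M \<and> second_countable M \<and>
     (\<forall>c\<in>A. is_chart M c) \<and> (\<Union>c\<in>A. fst c) = topspace M \<and>
     (\<forall>c\<in>A. \<forall>d\<in>A. smooth_on (snd c ` (fst c \<inter> fst d)) (snd d \<circ> chart_inv c))"

definition smooth_map :: "('a, 'n::finite) chart set \<Rightarrow> ('a \<Rightarrow> 'v::real_normed_vector) \<Rightarrow> bool" where
  "smooth_map A Y \<longleftrightarrow> (\<forall>c\<in>A. smooth_on (snd c ` fst c) (Y \<circ> chart_inv c))"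

definition smooth_family ::
    "('a, 'n::finite) chart set \<Rightarrow> real set \<Rightarrow> (real \<Rightarrow> 'a \<Rightarrow> 'v::real_normed_vector) \<Rightarrow> bool" where
  "smooth_family A I X \<longleftrightarrow>
     (\<forall>c\<in>A. smooth_on (I \<times> snd c ` fst c) (\<lambda>(s, x). X s (chart_inv c x)))"

text \<open>The differential of \<open>Y\<close> at \<open>p\<close>, tangent vectors being given by their components in the
  chart \<open>c\<close>.\<close>

definition chart_deriv ::
    "('a, 'n::finite) chart \<Rightarrow> ('a \<Rightarrow> 'v::real_normed_vector) \<Rightarrow> 'a \<Rightarrow> real ^ 'n \<Rightarrow> 'v" where
  "chart_deriv c Y p = frechet_derivative (Y \<circ> chart_inv c) (at (snd c p))"

definition immersion :: "('a, 'n::finite) chart set \<Rightarrow> ('a \<Rightarrow> 'v::real_normed_vector) \<Rightarrow> bool" where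
  "immersion A X \<longleftrightarrow> smooth_map A X \<and> (\<forall>c\<in>A. \<forall>p\<in>fst c. inj (chart_deriv c X p))"

definition unit_normal ::
    "('a, 'n::finite) chart set \<Rightarrow> ('a \<Rightarrow> 'v::real_inner) \<Rightarrow> ('a \<Rightarrow> 'v) \<Rightarrow> bool" where
  "unit_normal A X N \<longleftrightarrow> smooth_map A N \<and>
     (\<forall>c\<in>A. \<forall>p\<in>fst c. norm (N p) = 1 \<and> (\<forall>v. N p \<bullet> chart_deriv c X p v = 0))"

definition metric_matrix ::
    "('a, 'n::finite) chart \<Rightarrow> ('a \<Rightarrow> 'v::real_inner) \<Rightarrow> 'a \<Rightarrow> real ^ 'n ^ 'n" where
  "metric_matrix c X p =
     (\<chi> i j. chart_deriv c X p (axis i 1) \<bullet> chart_deriv c X p (axis j 1))"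

text \<open>\<open>\<mu>\<close> is the area measure of \<open>X\<close>: the Borel measure on \<open>M\<close> equal to
  \<open>sqrt (det g\<^sub>i\<^sub>j) dx\<close> in every chart. These conditions determine \<open>\<mu>\<close> uniquely, and by the change
  of variables formula they are compatible on overlaps of charts.\<close>

definition area_measure ::
    "'a topology \<Rightarrow> ('a, 'n::finite) chart set \<Rightarrow> ('a \<Rightarrow> 'v::real_inner) \<Rightarrow> 'a measure \<Rightarrow> bool" where
  "area_measure M A X \<mu> \<longleftrightarrow>
     space \<mu> = topspace M \<and> sets \<mu> = sigma_sets (topspace M) {U. openin M U} \<and>
     (\<forall>c\<in>A. \<forall>B\<in>sets \<mu>. B \<subseteq> fst c \<longrightarrow>
        emeasure \<mu> B =
          (\<integral>\<^sup>+x\<in>snd c ` B. ennreal (sqrt (det (metric_matrix c X (chart_inv c x)))) \<partial>lborel))"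

definition orthonormal_frame ::
    "('a, 'n::finite) chart \<Rightarrow> ('a \<Rightarrow> 'v::real_inner) \<Rightarrow> 'a \<Rightarrow> ('n \<Rightarrow> real ^ 'n) \<Rightarrow> bool" where
  "orthonormal_frame c X p e \<longleftrightarrow>
     (\<forall>i j. chart_deriv c X p (e i) \<bullet> chart_deriv c X p (e j) = (if i = j then 1 else 0))"

text \<open>\<open>h (v, w) = - \<langle>D\<^sub>v N, w\<rangle>\<close>\<close>

definition second_fundamental_form ::
    "('a, 'n::finite) chart \<Rightarrow> ('a \<Rightarrow> 'v::real_inner) \<Rightarrow> ('a \<Rightarrow> 'v) \<Rightarrow> 'a \<Rightarrow> real ^ 'n \<Rightarrow> real ^ 'n \<Rightarrow> real"
  where
  "second_fundamental_form c X N p v w = - (chart_deriv c N p v \<bullet> chart_deriv c X p w)"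

text \<open>The trace of \<open>h\<close>: the value common to all charts around \<open>p\<close> and all orthonormal tangent
  frames. Note that it is not divided by the dimension.\<close>

definition mean_curvature ::
    "('a, 'n::finite) chart set \<Rightarrow> ('a \<Rightarrow> 'v::real_inner) \<Rightarrow> ('a \<Rightarrow> 'v) \<Rightarrow> 'a \<Rightarrow> real" where
  "mean_curvature A X N p =
     (THE H. \<forall>c\<in>A. p \<in> fst c \<longrightarrow> (\<forall>e. orthonormal_frame c X p e \<longrightarrow>
        H = (\<Sum>i\<in>UNIV. second_fundamental_form c X N p (e i) (e i))))"

text \<open>\<open>X\<close>, \<open>\<mu>\<close>, \<open>x\<close>, \<open>t\<close> are the families \<open>X(s)\<close>, \<open>d\<mu>\<^sub>s\<close>, \<open>X\<^sub>s\<close>, \<open>t\<^sub>s\<close>; their values at \<open>s = 0\<close> are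
  \<open>X\<close>, \<open>d\<mu>\<close>, \<open>X\<^sub>0\<close>, \<open>t\<^sub>0\<close>. The field \<open>N\<close> is the unit normal of \<open>X 0\<close> for every \<open>s\<close>.\<close>

definition F_functional ::
    "nat \<Rightarrow> real \<Rightarrow> (real \<Rightarrow> 'a measure) \<Rightarrow> (real \<Rightarrow> 'a \<Rightarrow> 'v::real_inner) \<Rightarrow> ('a \<Rightarrow> 'v) \<Rightarrow>
     (real \<Rightarrow> 'v) \<Rightarrow> (real \<Rightarrow> real) \<Rightarrow> real \<Rightarrow> real" where
  "F_functional n lam \<mu> X N x t s =
     (4 * pi * t s) powr (- real n / 2) *
       (\<integral>p. exp (- (norm (X s p - x s))\<^sup>2 / (2 * t s)) \<partial>\<mu> s)
   + lam * (4 * pi * t 0) powr (- real n / 2) * sqrt (t 0 / t s) *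
       (\<integral>p. ((X s p - x s) \<bullet> N p) * exp (- (norm (X 0 p - x 0))\<^sup>2 / (2 * t 0)) \<partial>\<mu> 0)"

end

theory Submission
  imports Defs
begin

text \<open>
  The first integral of the functional is taken against the moving measure \<open>\<mu> s\<close>. Everything
  rests on moving it to the fixed measure \<open>\<mu> 0\<close>: near \<open>s = 0\<close> one has
  \<open>\<mu> s = sqrt (D s) \<cdot> \<mu> 0\<close>, where \<open>D s p = det g\<^sub>s / det g\<^sub>0\<close> is a ratio of Gram determinants of the
  metric in one chart around \<open>p\<close> (lemma \<open>relative_area_density\<close>). After this step only two integrals
  over a fixed measure space depend on \<open>s\<close>, and the formula is differentiation under the integral
  sign (lemma \<open>has_real_derivative_integral_at\<close>) followed by linearity.

  The derivative of \<open>D\<close> is where the mean curvature enters. Pull a frame that is orthonormal for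
  \<open>X 0\<close> back to the chart. In this frame \<open>D s p\<close> is the determinant of the matrix of
  \<open>\<langle>dX\<^sub>s e\<^sub>i, dX\<^sub>s e\<^sub>j\<rangle>\<close>, which is the identity at \<open>s = 0\<close>, so its derivative is the trace
  \<open>\<Sum>\<^sub>i 2 \<langle>\<partial>\<^sub>s dX e\<^sub>i, dX e\<^sub>i\<rangle>\<close>. Mixed partial derivatives commute, hence \<open>\<partial>\<^sub>s dX = d(f N)\<close>; the part of
  \<open>d(f N)\<close> along \<open>N\<close> is killed by the inner product with a tangent vector, and what is left is
  \<open>2 f \<Sum>\<^sub>i \<langle>dN e\<^sub>i, dX e\<^sub>i\<rangle> = - 2 f H\<close> (lemma \<open>derivative_of_metric_det\<close>). That the definite description of \<open>H\<close>
  denotes this trace requires that the trace is the same for all charts and frames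
  (lemma \<open>mean_curvature_eq_trace\<close>).

  Differentiation under the integral needs one integrable majorant of the difference quotients.
  Compactness of the support of the variation gives a constant \<open>B\<close> such that, for small \<open>s\<close>, \<open>X s\<close> and \<open>D s\<close> differ from
  their values at \<open>0\<close> by at most \<open>B \<bar>s\<bar>\<close> everywhere on \<open>M\<close>. Moving the centre, the scale and the
  immersion of a Gaussian by \<open>O(s)\<close> changes it by at most a constant times \<open>\<bar>s\<bar>\<close> times a
  slightly wider Gaussian (lemma \<open>gaussian_lipschitz\<close>), and the hypothesis on finite integrals supplies the
  integrability of that wider Gaussian. Factors that grow polynomially at infinity are absorbed by
  widening the Gaussian once more (lemma \<open>polynomial_times_gaussian_le\<close>).
\<close>

section \<open>Differentiation under the integral sign\<close>

text \<open>Dominated convergence applied to the difference quotients at the single point \<open>a\<close>. Bounding the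
  quotients themselves, rather than derivatives at nearby parameters, means that the integrands have to be
  differentiable at \<open>a\<close> only.\<close>

lemma has_real_derivative_integral_at:
  fixes \<Phi> :: "real \<Rightarrow> 'a \<Rightarrow> real"
  assumes meas: "\<forall>\<^sub>F s in nhds a. \<Phi> s \<in> borel_measurable M"
    and int: "integrable M (\<Phi> a)" "integrable M g"
    and dom: "\<forall>\<^sub>F s in nhds a. \<forall>p\<in>space M. \<bar>\<Phi> s p - \<Phi> a p\<bar> \<le> \<bar>s - a\<bar> * g p"
    and der: "\<And>p. p \<in> space M \<Longrightarrow> ((\<lambda>s. \<Phi> s p) has_real_derivative \<Phi>' p) (at a)"
  shows "integrable M \<Phi>'"
    and "((\<lambda>s. \<integral>p. \<Phi> s p \<partial>M) has_real_derivative (\<integral>p. \<Phi>' p \<partial>M)) (at a)"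
proof -
  define P where "P s \<longleftrightarrow> \<Phi> s \<in> borel_measurable M \<and> (\<forall>p\<in>space M. \<bar>\<Phi> s p - \<Phi> a p\<bar> \<le> \<bar>s - a\<bar> * g p)" for s
  have evP: "eventually P (nhds a)" unfolding P_def using meas dom by eventually_elim auto
  have intP: "integrable M (\<Phi> s)" if "P s" for s
  proof -
    have "integrable M (\<lambda>p. \<Phi> s p - \<Phi> a p)"
    proof (rule Bochner_Integration.integrable_bound)
      show "integrable M (\<lambda>p. \<bar>s - a\<bar> * g p)" using int by simp
      show "(\<lambda>p. \<Phi> s p - \<Phi> a p) \<in> borel_measurable M"
        using that int unfolding P_def by (intro borel_measurable_diff) auto
      show "AE p in M. norm (\<Phi> s p - \<Phi> a p) \<le> norm (\<bar>s - a\<bar> * g p)"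
        using that unfolding P_def by (intro AE_I2) (auto intro: order_trans[OF _ abs_ge_self])
    qed
    from Bochner_Integration.integrable_add[OF this int(1)] show ?thesis by simp
  qed
  have key: "integrable M \<Phi>' \<and> (\<lambda>i. ((\<integral>p. \<Phi> (X i) p \<partial>M) - (\<integral>p. \<Phi> a p \<partial>M)) / (X i - a)) \<longlonglongrightarrow> (\<integral>p. \<Phi>' p \<partial>M)"
    if X: "\<And>i. X i \<noteq> a" "X \<longlonglongrightarrow> a" for X
  proof -
    have "\<forall>\<^sub>F i in sequentially. P (X i)" using evP X(2) by (rule eventually_compose_filterlim)
    then obtain K where K: "\<And>i. i \<ge> K \<Longrightarrow> P (X i)" by (auto simp: eventually_sequentially)
    define Y where "Y i = X (i + K)" for i
    have Y: "Y \<longlonglongrightarrow> a" "\<And>i. Y i \<noteq> a" "\<And>i. P (Y i)" 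
      using X K LIMSEQ_ignore_initial_segment[OF X(2), of K] unfolding Y_def by auto
    define q where "q i p = (\<Phi> (Y i) p - \<Phi> a p) / (Y i - a)" for i p
    have lim: "(\<lambda>i. q i p) \<longlonglongrightarrow> \<Phi>' p" if "p \<in> space M" for p
    proof -
      have "((\<lambda>s. (\<Phi> s p - \<Phi> a p) / (s - a)) \<longlongrightarrow> \<Phi>' p) (at a)"
        using der[OF that] by (simp add: has_field_derivative_iff)
      then show ?thesis unfolding q_def using Y(1,2)
        by (auto simp: tendsto_at_iff_sequentially o_def)
    qed
    have qm: "q i \<in> borel_measurable M" for i
      unfolding q_def using Y(3)[of i] int by (auto simp: P_def)
    have \<Phi>'m: "\<Phi>' \<in> borel_measurable M"
      by (rule borel_measurable_LIMSEQ_real[OF lim qm])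
    have qb: "AE p in M. norm (q i p) \<le> g p" for i
    proof (rule AE_I2)
      fix p assume "p \<in> space M"
      then have "\<bar>\<Phi> (Y i) p - \<Phi> a p\<bar> \<le> \<bar>Y i - a\<bar> * g p" using Y(3)[of i] by (auto simp: P_def)
      moreover have "\<bar>Y i - a\<bar> > 0" using Y(2)[of i] by simp
      ultimately show "norm (q i p) \<le> g p" unfolding q_def by (simp add: abs_divide divide_le_eq mult.commute)
    qed
    have L: "AE p in M. (\<lambda>i. q i p) \<longlonglongrightarrow> \<Phi>' p" using lim by (intro AE_I2) auto
    have 1: "integrable M \<Phi>'"
      by (rule integrable_dominated_convergence[OF \<Phi>'m qm int(2) L qb])
    have 2: "(\<lambda>i. \<integral>p. q i p \<partial>M) \<longlonglongrightarrow> (\<integral>p. \<Phi>' p \<partial>M)"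
      by (rule integral_dominated_convergence[OF \<Phi>'m qm int(2) L qb])
    have 3: "(\<integral>p. q i p \<partial>M) = ((\<integral>p. \<Phi> (Y i) p \<partial>M) - (\<integral>p. \<Phi> a p \<partial>M)) / (Y i - a)" for i
      unfolding q_def using intP[OF Y(3)[of i]] int by simp
    have "(\<lambda>i. ((\<integral>p. \<Phi> (X i) p \<partial>M) - (\<integral>p. \<Phi> a p \<partial>M)) / (X i - a)) \<longlonglongrightarrow> (\<integral>p. \<Phi>' p \<partial>M)"
      using 2 unfolding 3 unfolding Y_def by (rule LIMSEQ_offset)
    with 1 show ?thesis by simp
  qed
  have "(\<lambda>i. a + inverse (real (Suc i))) \<longlonglongrightarrow> a"
    using tendsto_add[OF tendsto_const[of a] LIMSEQ_inverse_real_of_nat] by simp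
  from key[OF _ this] show "integrable M \<Phi>'" by simp
  show "((\<lambda>s. \<integral>p. \<Phi> s p \<partial>M) has_real_derivative (\<integral>p. \<Phi>' p \<partial>M)) (at a)"
    unfolding has_field_derivative_iff tendsto_at_iff_sequentially
    using key by (auto simp: o_def)
qed

section \<open>Partial derivatives of smooth maps\<close>

lemma smooth_on_differentiable: "smooth_on S F \<Longrightarrow> z \<in> S \<Longrightarrow> F differentiable (at z)"
  unfolding smooth_on_def using Ck_on.simps(2)[of 0 S F] by blast

lemma smooth_on_continuous: "smooth_on S F \<Longrightarrow> continuous_on S F"
  unfolding smooth_on_def using Ck_on.simps(1)[of S F] by blast

lemma smooth_on_directional: "smooth_on S F \<Longrightarrow> smooth_on S (\<lambda>z. frechet_derivative F (at z) u)"
  unfolding smooth_on_def using Ck_on.simps(2)[of _ S F] by blast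

lemma partial_derivatives:
  fixes F :: "real \<times> 'a::real_normed_vector \<Rightarrow> 'b::real_normed_vector"
  assumes "F differentiable (at (s, x))"
  shows "((\<lambda>s. F (s, x)) has_vector_derivative frechet_derivative F (at (s, x)) (1, 0)) (at s)"
    and "((\<lambda>x. F (s, x)) has_derivative (\<lambda>v. frechet_derivative F (at (s, x)) (0, v))) (at x)"
proof -
  let ?D = "frechet_derivative F (at (s, x))"
  have d: "(F has_derivative ?D) (at (s, x))" using assms by (simp add: frechet_derivative_works)
  show "((\<lambda>x. F (s, x)) has_derivative (\<lambda>v. ?D (0, v))) (at x)"
    by (rule has_derivative_compose[where g = F and f = "\<lambda>x. (s, x)", OF _ d]) (auto intro!: derivative_eq_intros)
  have d1: "((\<lambda>s. F (s, x)) has_derivative (\<lambda>r. ?D (r, 0))) (at s)"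
    by (rule has_derivative_compose[where g = F and f = "\<lambda>s. (s, x)", OF _ d]) (auto intro!: derivative_eq_intros)
  have e: "(\<lambda>r. ?D (r, 0)) = (\<lambda>r. r *\<^sub>R ?D (1, 0))"
  proof
    fix r :: real
    show "?D (r, 0) = r *\<^sub>R ?D (1, 0)"
      using linear_cmul[OF linear_frechet_derivative[OF assms], of r "(1, 0)"] by simp
  qed
  show "((\<lambda>s. F (s, x)) has_vector_derivative ?D (1, 0)) (at s)"
    unfolding has_vector_derivative_def e[symmetric] by (rule d1)
qed

text \<open>Two applications of the mean value theorem to the second difference of \<open>F\<close> over a
  parallelogram spanned by \<open>h u\<close> and \<open>h v\<close>. Pairing with a vector \<open>b\<close> makes the function real-valued, as the mean
  value theorem requires.\<close>

lemma second_difference_quotient: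
  fixes F :: "'a::real_normed_vector \<Rightarrow> 'b::real_inner"
  assumes dF: "\<And>z. z \<in> S \<Longrightarrow> F differentiable (at z)"
    and ddF: "\<And>z. z \<in> S \<Longrightarrow> (\<lambda>z. frechet_derivative F (at z) u) differentiable (at z)"
    and h: "h > 0" and box: "\<And>a b. 0 \<le> a \<Longrightarrow> a \<le> h \<Longrightarrow> 0 \<le> b \<Longrightarrow> b \<le> h \<Longrightarrow> z + a *\<^sub>R u + b *\<^sub>R v \<in> S"
  obtains \<xi> \<zeta> where "0 < \<xi>" "\<xi> < h" "0 < \<zeta>" "\<zeta> < h"
    "(F (z + h *\<^sub>R u + h *\<^sub>R v) - F (z + h *\<^sub>R u) - F (z + h *\<^sub>R v) + F z) \<bullet> b
      = h\<^sup>2 * (frechet_derivative (\<lambda>z. frechet_derivative F (at z) u) (at (z + \<xi> *\<^sub>R u + \<zeta> *\<^sub>R v)) v \<bullet> b)"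
proof -
  define D where "D z = frechet_derivative F (at z) u" for z
  have line: "((\<lambda>a. F (p + a *\<^sub>R u) \<bullet> b) has_real_derivative D (p + a *\<^sub>R u) \<bullet> b) (at a)"
    if "p + a *\<^sub>R u \<in> S" for p a
  proof -
    have F: "(F has_derivative frechet_derivative F (at (p + a *\<^sub>R u))) (at (p + a *\<^sub>R u))"
      using dF[OF that] by (simp add: frechet_derivative_works)
    have "((\<lambda>a. F (p + a *\<^sub>R u)) has_derivative (\<lambda>x. frechet_derivative F (at (p + a *\<^sub>R u)) (x *\<^sub>R u))) (at a)"
      by (rule has_derivative_compose[where g = F and f = "\<lambda>a. p + a *\<^sub>R u", OF _ F]) (auto intro!: derivative_eq_intros)
    then have "((\<lambda>a. F (p + a *\<^sub>R u) \<bullet> b) has_derivative (\<lambda>x. frechet_derivative F (at (p + a *\<^sub>R u)) (x *\<^sub>R u) \<bullet> b)) (at a)"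
      by (rule has_derivative_inner_left)
    also have "(\<lambda>x. frechet_derivative F (at (p + a *\<^sub>R u)) (x *\<^sub>R u) \<bullet> b) = (*) (D (p + a *\<^sub>R u) \<bullet> b)"
      unfolding D_def using linear_frechet_derivative[OF dF[OF that]] by (auto simp: linear_cmul fun_eq_iff)
    finally show ?thesis by (simp add: has_field_derivative_def)
  qed
  have line2: "((\<lambda>a. D (p + a *\<^sub>R v) \<bullet> b) has_real_derivative frechet_derivative D (at (p + a *\<^sub>R v)) v \<bullet> b) (at a)"
    if "p + a *\<^sub>R v \<in> S" for p a
  proof -
    have dd: "D differentiable (at (p + a *\<^sub>R v))" using ddF[OF that] unfolding D_def .
    have F: "(D has_derivative frechet_derivative D (at (p + a *\<^sub>R v))) (at (p + a *\<^sub>R v))"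
      using dd by (simp add: frechet_derivative_works)
    have "((\<lambda>a. D (p + a *\<^sub>R v)) has_derivative (\<lambda>x. frechet_derivative D (at (p + a *\<^sub>R v)) (x *\<^sub>R v))) (at a)"
      by (rule has_derivative_compose[where g = D and f = "\<lambda>a. p + a *\<^sub>R v", OF _ F]) (auto intro!: derivative_eq_intros)
    then have "((\<lambda>a. D (p + a *\<^sub>R v) \<bullet> b) has_derivative (\<lambda>x. frechet_derivative D (at (p + a *\<^sub>R v)) (x *\<^sub>R v) \<bullet> b)) (at a)"
      by (rule has_derivative_inner_left)
    also have "(\<lambda>x. frechet_derivative D (at (p + a *\<^sub>R v)) (x *\<^sub>R v) \<bullet> b) = (*) (frechet_derivative D (at (p + a *\<^sub>R v)) v \<bullet> b)"
      using linear_frechet_derivative[OF dd] by (auto simp: linear_cmul fun_eq_iff)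
    finally show ?thesis by (simp add: has_field_derivative_def)
  qed
  define g where "g a = F (z + h *\<^sub>R v + a *\<^sub>R u) \<bullet> b - F (z + a *\<^sub>R u) \<bullet> b" for a
  have mem: "z + h *\<^sub>R v + a *\<^sub>R u \<in> S" "z + a *\<^sub>R u \<in> S" if "0 \<le> a" "a \<le> h" for a
    using box[of a h] box[of a 0] that h by (auto simp: algebra_simps)
  have "\<exists>\<xi>. \<xi> > 0 \<and> \<xi> < h \<and> g h - g 0 = (h - 0) * (D (z + h *\<^sub>R v + \<xi> *\<^sub>R u) \<bullet> b - D (z + \<xi> *\<^sub>R u) \<bullet> b)"
    by (rule MVT2[OF h]) (unfold g_def, intro DERIV_diff line mem)
  then obtain \<xi> where \<xi>: "0 < \<xi>" "\<xi> < h" 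
    "g h - g 0 = h * (D (z + \<xi> *\<^sub>R u + h *\<^sub>R v) \<bullet> b - D (z + \<xi> *\<^sub>R u) \<bullet> b)" by (auto simp: ac_simps)
  have mem2: "z + \<xi> *\<^sub>R u + a *\<^sub>R v \<in> S" if "0 \<le> a" "a \<le> h" for a
    using box[of \<xi> a] that \<xi> by auto
  have "\<exists>\<zeta>. \<zeta> > 0 \<and> \<zeta> < h \<and> D (z + \<xi> *\<^sub>R u + h *\<^sub>R v) \<bullet> b - D (z + \<xi> *\<^sub>R u + 0 *\<^sub>R v) \<bullet> b
     = (h - 0) * (frechet_derivative D (at (z + \<xi> *\<^sub>R u + \<zeta> *\<^sub>R v)) v \<bullet> b)"
    by (rule MVT2[OF h]) (intro line2 mem2)
  then obtain \<zeta> where \<zeta>: "0 < \<zeta>" "\<zeta> < h" "D (z + \<xi> *\<^sub>R u + h *\<^sub>R v) \<bullet> b - D (z + \<xi> *\<^sub>R u) \<bullet> b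
     = h * (frechet_derivative D (at (z + \<xi> *\<^sub>R u + \<zeta> *\<^sub>R v)) v \<bullet> b)" by auto
  show thesis
  proof (rule that[OF \<xi>(1,2) \<zeta>(1,2)])
    have "(F (z + h *\<^sub>R u + h *\<^sub>R v) - F (z + h *\<^sub>R u) - F (z + h *\<^sub>R v) + F z) \<bullet> b = g h - g 0"
      unfolding g_def by (simp add: inner_diff_left inner_add_left algebra_simps)
    also have "\<dots> = h\<^sup>2 * (frechet_derivative D (at (z + \<xi> *\<^sub>R u + \<zeta> *\<^sub>R v)) v \<bullet> b)"
      unfolding \<xi>(3) \<zeta>(3) by (simp add: power2_eq_square)
    finally show "(F (z + h *\<^sub>R u + h *\<^sub>R v) - F (z + h *\<^sub>R u) - F (z + h *\<^sub>R v) + F z) \<bullet> b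
      = h\<^sup>2 * (frechet_derivative (\<lambda>z. frechet_derivative F (at z) u) (at (z + \<xi> *\<^sub>R u + \<zeta> *\<^sub>R v)) v \<bullet> b)"
      unfolding D_def .
  qed
qed

text \<open>The second difference over the parallelogram is symmetric in \<open>u\<close> and \<open>v\<close>, while the previous lemma
  writes it, divided by \<open>h\<^sup>2\<close>, as either mixed derivative at a point that tends to \<open>z\<close> with \<open>h\<close>.
  Continuity of the mixed derivatives then identifies them at \<open>z\<close>.\<close>

lemma mixed_derivatives_commute:
  fixes F :: "'a::real_normed_vector \<Rightarrow> 'b::real_inner"
  assumes F: "smooth_on S F" and S: "open S" and z: "z \<in> S"
  shows "frechet_derivative (\<lambda>z. frechet_derivative F (at z) u) (at z) v
       = frechet_derivative (\<lambda>z. frechet_derivative F (at z) v) (at z) u"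
proof -
  define Q where "Q u v z = frechet_derivative (\<lambda>z. frechet_derivative F (at z) u) (at z) v" for u v z
  have cont: "isCont (Q u v) z" for u v
    using smooth_on_continuous[OF smooth_on_directional[OF smooth_on_directional[OF F]]] S z
    unfolding Q_def by (simp add: continuous_on_eq_continuous_at)
  obtain r where r: "r > 0" "ball z r \<subseteq> S" using S z openE by blast
  \<comment> \<open>Sizes \<open>h n\<close> tending to \<open>0\<close> for which the whole parallelogram stays in the ball around \<open>z\<close>.\<close>
  define K where "K = 1 + norm u + norm v"
  have K: "K > 0" unfolding K_def by (smt (verit) norm_ge_zero)
  define h where "h n = r / K / real (n + 2)" for n
  have hpos: "h n > 0" for n unfolding h_def using r K by simp
  have hlim: "h \<longlonglongrightarrow> 0" unfolding h_def
    by (rule LIMSEQ_ignore_initial_segment[where f = "\<lambda>n. r / K / real n"]) (rule lim_const_over_n)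
  have near: "norm (a *\<^sub>R u + b *\<^sub>R v) \<le> h n * K" if "0 \<le> a" "a \<le> h n" "0 \<le> b" "b \<le> h n" for a b n
  proof -
    have "norm (a *\<^sub>R u + b *\<^sub>R v) \<le> a * norm u + b * norm v"
      using norm_triangle_ineq[of "a *\<^sub>R u" "b *\<^sub>R v"] that by simp
    also have "\<dots> \<le> h n * norm u + h n * norm v"
      using that by (intro add_mono mult_right_mono) auto
    also have "\<dots> \<le> h n * K" unfolding K_def using hpos[of n] by (simp add: algebra_simps)
    finally show ?thesis .
  qed
  have hK: "h n * K < r" for n
  proof -
    have "h n * K = r / real (n + 2)" unfolding h_def using K by simp
    also have "\<dots> < r" using r by (simp add: divide_less_eq)
    finally show ?thesis .
  qed
  have box: "z + a *\<^sub>R u + b *\<^sub>R v \<in> S" if "0 \<le> a" "a \<le> h n" "0 \<le> b" "b \<le> h n" for a b n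
  proof -
    have "dist z (z + a *\<^sub>R u + b *\<^sub>R v) = norm (a *\<^sub>R u + b *\<^sub>R v)"
      using dist_add_cancel[of z 0 "a *\<^sub>R u + b *\<^sub>R v"] by (simp add: add.assoc)
    then have "z + a *\<^sub>R u + b *\<^sub>R v \<in> ball z r" using near[OF that] hK[of n] by simp
    then show ?thesis using r by blast
  qed
  define \<Delta> where "\<Delta> n = F (z + h n *\<^sub>R u + h n *\<^sub>R v) - F (z + h n *\<^sub>R u) - F (z + h n *\<^sub>R v) + F z" for n
  have lim: "(\<lambda>n. R (z + \<xi> n *\<^sub>R u + \<zeta> n *\<^sub>R v) \<bullet> b) \<longlonglongrightarrow> R z \<bullet> b" 
    if \<xi>\<zeta>: "\<And>n. 0 < \<xi> n \<and> \<xi> n < h n \<and> 0 < \<zeta> n \<and> \<zeta> n < h n" and R: "isCont R z" for R :: "'a \<Rightarrow> 'b" and \<xi> \<zeta> b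
  proof -
    have "(\<lambda>n. z + \<xi> n *\<^sub>R u + \<zeta> n *\<^sub>R v) \<longlonglongrightarrow> z"
    proof (rule LIM_zero_cancel, rule Lim_null_comparison)
      show "\<forall>\<^sub>F n in sequentially. norm (z + \<xi> n *\<^sub>R u + \<zeta> n *\<^sub>R v - z) \<le> h n * K"
        using near \<xi>\<zeta> by (intro always_eventually allI) (simp add: add.assoc less_imp_le)
      show "(\<lambda>n. h n * K) \<longlonglongrightarrow> 0" using tendsto_mult_left_zero[OF hlim] .
    qed
    with R show ?thesis by (intro tendsto_inner tendsto_const) (auto intro: isCont_tendsto_compose)
  qed
  have "Q u v z \<bullet> b = Q v u z \<bullet> b" for b
  proof -
    have "\<exists>\<xi> \<zeta>. 0 < \<xi> \<and> \<xi> < h n \<and> 0 < \<zeta> \<and> \<zeta> < h n \<and> \<Delta> n \<bullet> b = (h n)\<^sup>2 * (Q u v (z + \<xi> *\<^sub>R u + \<zeta> *\<^sub>R v) \<bullet> b)" for n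
      by (rule second_difference_quotient[of S F u "h n" z v b])
         (auto intro!: smooth_on_differentiable[OF F] smooth_on_differentiable[OF smooth_on_directional[OF F]]
            hpos box simp: Q_def \<Delta>_def)
    then obtain \<xi> \<zeta> where 1: "\<And>n. 0 < \<xi> n \<and> \<xi> n < h n \<and> 0 < \<zeta> n \<and> \<zeta> n < h n"
       "\<And>n. \<Delta> n \<bullet> b = (h n)\<^sup>2 * (Q u v (z + \<xi> n *\<^sub>R u + \<zeta> n *\<^sub>R v) \<bullet> b)" by metis
    have "\<exists>\<xi> \<zeta>. 0 < \<xi> \<and> \<xi> < h n \<and> 0 < \<zeta> \<and> \<zeta> < h n \<and> \<Delta> n \<bullet> b = (h n)\<^sup>2 * (Q v u (z + \<zeta> *\<^sub>R u + \<xi> *\<^sub>R v) \<bullet> b)" for n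
    proof (rule second_difference_quotient[of S F v "h n" z u b])
      fix a c assume *: "0 \<le> a" "a \<le> h n" "0 \<le> c" "c \<le> h n"
      have e: "z + a *\<^sub>R v + c *\<^sub>R u = z + c *\<^sub>R u + a *\<^sub>R v" by (simp add: ac_simps)
      show "z + a *\<^sub>R v + c *\<^sub>R u \<in> S" unfolding e by (rule box[OF *(3,4,1,2)])
    next
      fix \<xi> \<zeta> assume *: "0 < \<xi>" "\<xi> < h n" "0 < \<zeta>" "\<zeta> < h n"
        "(F (z + h n *\<^sub>R v + h n *\<^sub>R u) - F (z + h n *\<^sub>R v) - F (z + h n *\<^sub>R u) + F z) \<bullet> b
          = (h n)\<^sup>2 * (frechet_derivative (\<lambda>z. frechet_derivative F (at z) v) (at (z + \<xi> *\<^sub>R v + \<zeta> *\<^sub>R u)) u \<bullet> b)"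
      have "z + \<xi> *\<^sub>R v + \<zeta> *\<^sub>R u = z + \<zeta> *\<^sub>R u + \<xi> *\<^sub>R v" by (simp add: ac_simps)
      moreover have "F (z + h n *\<^sub>R v + h n *\<^sub>R u) - F (z + h n *\<^sub>R v) - F (z + h n *\<^sub>R u) + F z = \<Delta> n"
        unfolding \<Delta>_def by (simp add: algebra_simps)
      ultimately show ?thesis using * unfolding Q_def by metis
    qed (auto intro!: smooth_on_differentiable[OF F] smooth_on_differentiable[OF smooth_on_directional[OF F]] hpos)
    then obtain \<xi>' \<zeta>' where 2: "\<And>n. 0 < \<zeta>' n \<and> \<zeta>' n < h n \<and> 0 < \<xi>' n \<and> \<xi>' n < h n"
       "\<And>n. \<Delta> n \<bullet> b = (h n)\<^sup>2 * (Q v u (z + \<zeta>' n *\<^sub>R u + \<xi>' n *\<^sub>R v) \<bullet> b)" by metis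
    have "Q u v (z + \<xi> n *\<^sub>R u + \<zeta> n *\<^sub>R v) \<bullet> b = Q v u (z + \<zeta>' n *\<^sub>R u + \<xi>' n *\<^sub>R v) \<bullet> b" for n
      using 1(2)[of n] 2(2)[of n] hpos[of n] by simp
    then show ?thesis
      using lim[OF 1(1) cont, of u v b] lim[OF 2(1) cont, of v u b] LIMSEQ_unique by auto
  qed
  then show ?thesis unfolding Q_def[symmetric] by (metis inner_commute vector_eq_rdot)
qed

section \<open>Uniform Lipschitz bounds in the parameter\<close>

text \<open>Closed under sums and products, so that the Gram determinant inherits the property from the tangent vectors;
  this avoids joint continuity of the derivative of the determinant. Boundedness at \<open>0\<close> is
  included because products need it.\<close>

definition lipschitz_at_0 :: "'p set \<Rightarrow> (real \<Rightarrow> 'p \<Rightarrow> 'b::real_normed_vector) \<Rightarrow> bool" where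
  "lipschitz_at_0 C G \<longleftrightarrow> bounded (G 0 ` C) \<and>
     (\<exists>B. \<forall>\<^sub>F s in nhds 0. \<forall>p\<in>C. norm (G s p - G 0 p) \<le> B * \<bar>s\<bar>)"

lemma lipschitz_at_0_const: "bounded (g ` C) \<Longrightarrow> lipschitz_at_0 C (\<lambda>s. g)"
  unfolding lipschitz_at_0_def by (auto intro!: exI[of _ 0])

lemma lipschitz_at_0_add:
  assumes "lipschitz_at_0 C G" "lipschitz_at_0 C K"
  shows "lipschitz_at_0 C (\<lambda>s p. G s p + K s p)"
proof -
  obtain B B' where "\<forall>\<^sub>F s in nhds 0. \<forall>p\<in>C. norm (G s p - G 0 p) \<le> B * \<bar>s\<bar>" 
    "\<forall>\<^sub>F s in nhds 0. \<forall>p\<in>C. norm (K s p - K 0 p) \<le> B' * \<bar>s\<bar>"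
    using assms unfolding lipschitz_at_0_def by blast
  then have "\<forall>\<^sub>F s in nhds 0. \<forall>p\<in>C. norm ((G s p + K s p) - (G 0 p + K 0 p)) \<le> (B + B') * \<bar>s\<bar>"
  proof eventually_elim
    case (elim s)
    show ?case
    proof
      fix p assume p: "p \<in> C"
      have "norm ((G s p + K s p) - (G 0 p + K 0 p)) = norm ((G s p - G 0 p) + (K s p - K 0 p))"
        by (simp add: algebra_simps)
      also have "\<dots> \<le> B * \<bar>s\<bar> + B' * \<bar>s\<bar>" using elim p by (intro norm_triangle_mono) auto
      finally show "norm ((G s p + K s p) - (G 0 p + K 0 p)) \<le> (B + B') * \<bar>s\<bar>"
        by (simp add: algebra_simps)
    qed
  qed
  moreover have "bounded ((\<lambda>p. G 0 p + K 0 p) ` C)"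
    using assms unfolding lipschitz_at_0_def by (intro bounded_plus_comp) auto
  ultimately show ?thesis unfolding lipschitz_at_0_def by blast
qed

text \<open>Split \<open>G\<^sub>s K\<^sub>s - G\<^sub>0 K\<^sub>0 = (G\<^sub>s - G\<^sub>0) K\<^sub>s + G\<^sub>0 (K\<^sub>s - K\<^sub>0)\<close>; for \<open>\<bar>s\<bar> < 1\<close> the factor \<open>K\<^sub>s\<close> is bounded by
  the bound for \<open>K\<^sub>0\<close> plus the Lipschitz constant.\<close>

lemma lipschitz_at_0_bilinear:
  assumes pr: "bounded_bilinear pr" and "lipschitz_at_0 C G" "lipschitz_at_0 C K"
  shows "lipschitz_at_0 C (\<lambda>s p. pr (G s p) (K s p))"
proof -
  interpret bounded_bilinear pr by (rule pr)
  obtain B B' where B: "\<forall>\<^sub>F s in nhds 0. \<forall>p\<in>C. norm (G s p - G 0 p) \<le> B * \<bar>s\<bar>" 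
    "\<forall>\<^sub>F s in nhds 0. \<forall>p\<in>C. norm (K s p - K 0 p) \<le> B' * \<bar>s\<bar>"
    using assms(2,3) unfolding lipschitz_at_0_def by blast
  obtain m m' where m: "\<And>p. p \<in> C \<Longrightarrow> norm (G 0 p) \<le> m" "\<And>p. p \<in> C \<Longrightarrow> norm (K 0 p) \<le> m'"
    using assms(2,3) unfolding lipschitz_at_0_def bounded_iff by (metis imageI)
  obtain c where c: "c > 0" "\<And>a b. norm (pr a b) \<le> norm a * norm b * c"
    using pos_bounded by blast
  have "\<forall>\<^sub>F s in nhds (0::real). s \<in> {-1<..<1}" by (intro eventually_nhds_in_open) auto
  with B have "\<forall>\<^sub>F s in nhds 0. \<forall>p\<in>C. norm (pr (G s p) (K s p) - pr (G 0 p) (K 0 p))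
      \<le> ((\<bar>B\<bar> * (\<bar>m'\<bar> + \<bar>B'\<bar>) + \<bar>m\<bar> * \<bar>B'\<bar>) * c) * \<bar>s\<bar>"
  proof eventually_elim
    case (elim s)
    show ?case
    proof
      fix p assume p: "p \<in> C"
      have s: "\<bar>s\<bar> \<le> 1" using elim(3) by auto
      have 1: "norm (G s p - G 0 p) \<le> \<bar>B\<bar> * \<bar>s\<bar>" and 2: "norm (K s p - K 0 p) \<le> \<bar>B'\<bar> * \<bar>s\<bar>"
        using elim p by (auto intro!: order_trans[OF _ mult_right_mono[OF abs_ge_self abs_ge_zero]])
      have "norm (K s p) \<le> norm (K 0 p) + norm (K s p - K 0 p)"
        using norm_triangle_sub[of "K s p" "K 0 p"] by simp
      also have "\<dots> \<le> \<bar>m'\<bar> + \<bar>B'\<bar> * 1"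
        using m(2)[OF p] 2 mult_left_mono[OF s, of "\<bar>B'\<bar>"] by linarith
      finally have 3: "norm (K s p) \<le> \<bar>m'\<bar> + \<bar>B'\<bar>" by simp
      have "norm (pr (G s p - G 0 p) (K s p)) \<le> norm (G s p - G 0 p) * norm (K s p) * c" by (rule c)
      also have "\<dots> \<le> (\<bar>B\<bar> * \<bar>s\<bar>) * (\<bar>m'\<bar> + \<bar>B'\<bar>) * c"
        using 1 3 c(1) by (intro mult_mono) auto
      finally have 4: "norm (pr (G s p - G 0 p) (K s p)) \<le> (\<bar>B\<bar> * \<bar>s\<bar>) * (\<bar>m'\<bar> + \<bar>B'\<bar>) * c" .
      have "norm (pr (G 0 p) (K s p - K 0 p)) \<le> norm (G 0 p) * norm (K s p - K 0 p) * c" by (rule c)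
      also have "\<dots> \<le> \<bar>m\<bar> * (\<bar>B'\<bar> * \<bar>s\<bar>) * c"
        using m(1)[OF p] 2 c(1) by (intro mult_mono) auto
      finally have 5: "norm (pr (G 0 p) (K s p - K 0 p)) \<le> \<bar>m\<bar> * (\<bar>B'\<bar> * \<bar>s\<bar>) * c" .
      have "pr (G s p) (K s p) - pr (G 0 p) (K 0 p) = pr (G s p - G 0 p) (K s p) + pr (G 0 p) (K s p - K 0 p)"
        by (simp add: diff_left diff_right)
      then have "norm (pr (G s p) (K s p) - pr (G 0 p) (K 0 p))
          \<le> (\<bar>B\<bar> * \<bar>s\<bar>) * (\<bar>m'\<bar> + \<bar>B'\<bar>) * c + \<bar>m\<bar> * (\<bar>B'\<bar> * \<bar>s\<bar>) * c"
        using norm_triangle_mono[OF 4 5] by simp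
      then show "norm (pr (G s p) (K s p) - pr (G 0 p) (K 0 p))
          \<le> ((\<bar>B\<bar> * (\<bar>m'\<bar> + \<bar>B'\<bar>) + \<bar>m\<bar> * \<bar>B'\<bar>) * c) * \<bar>s\<bar>" by (simp add: algebra_simps)
    qed
  qed
  moreover have "bounded ((\<lambda>p. pr (G 0 p) (K 0 p)) ` C)"
  proof -
    have "norm (pr (G 0 p) (K 0 p)) \<le> \<bar>m\<bar> * \<bar>m'\<bar> * c" if "p \<in> C" for p
      by (rule order_trans[OF c(2)]) (use m[OF that] c(1) in \<open>intro mult_mono; force\<close>)
    then show ?thesis by (auto simp: bounded_iff)
  qed
  ultimately show ?thesis unfolding lipschitz_at_0_def by blast
qed

lemmas lipschitz_at_0_inner = lipschitz_at_0_bilinear[OF bounded_bilinear_inner]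

lemmas lipschitz_at_0_mult = lipschitz_at_0_bilinear[OF bounded_bilinear_mult]

lemma lipschitz_at_0_sum:
  assumes "\<And>i. i \<in> I \<Longrightarrow> lipschitz_at_0 C (G i)"
  shows "lipschitz_at_0 C (\<lambda>s p. \<Sum>i\<in>I. G i s p)"
proof -
  have b: "bounded ((\<lambda>p. 0) ` C)" by (rule finite_imp_bounded) (auto intro: finite_subset[of _ "{0}"])
  show ?thesis using assms
  by (induction I rule: infinite_finite_induct)
     (auto intro!: lipschitz_at_0_add lipschitz_at_0_const[OF b])
qed

lemma lipschitz_at_0_prod:
  fixes G :: "'i \<Rightarrow> real \<Rightarrow> 'p \<Rightarrow> real"
  assumes "\<And>i. i \<in> I \<Longrightarrow> lipschitz_at_0 C (G i)"
  shows "lipschitz_at_0 C (\<lambda>s p. \<Prod>i\<in>I. G i s p)"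
proof -
  have b: "bounded ((\<lambda>p. 1::real) ` C)" by (rule finite_imp_bounded) (auto intro: finite_subset[of _ "{1}"])
  show ?thesis using assms
  by (induction I rule: infinite_finite_induct)
     (auto intro!: lipschitz_at_0_mult lipschitz_at_0_const[OF b])
qed

lemma lipschitz_at_0_det:
  fixes G :: "real \<Rightarrow> 'p \<Rightarrow> real ^ 'n ^ 'n"
  assumes "\<And>i j. lipschitz_at_0 C (\<lambda>s p. G s p $ i $ j)"
  shows "lipschitz_at_0 C (\<lambda>s p. det (G s p))"
proof -
  have b: "bounded ((\<lambda>p. r::real) ` C)" for r by (rule finite_imp_bounded) (auto intro: finite_subset[of _ "{r}"])
  show ?thesis unfolding det_def
    by (intro lipschitz_at_0_sum lipschitz_at_0_mult lipschitz_at_0_prod lipschitz_at_0_const b assms)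
qed

text \<open>The partial derivative in \<open>s\<close> is jointly continuous, hence bounded on the compact set
  \<open>[-\<epsilon>/2, \<epsilon>/2] \<times> C\<close>.\<close>

lemma uniform_Lipschitz_in_parameter:
  fixes Q :: "real \<times> 'a::real_normed_vector \<Rightarrow> 'b::real_normed_vector"
  assumes Q: "smooth_on ({-\<epsilon><..<\<epsilon>} \<times> U) Q" and \<epsilon>: "\<epsilon> > 0" and C: "compact C" "C \<subseteq> U"
  obtains B where "\<forall>\<^sub>F s in nhds 0. \<forall>x\<in>C. norm (Q (s, x) - Q (0, x)) \<le> B * \<bar>s\<bar>"
proof -
  let ?T = "{-\<epsilon>/2..\<epsilon>/2} \<times> C"
  define G where "G z = frechet_derivative Q (at z) (1, 0)" for z
  have sub: "?T \<subseteq> {-\<epsilon><..<\<epsilon>} \<times> U" using C \<epsilon> by auto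
  have "continuous_on ?T G" unfolding G_def
    using continuous_on_subset[OF smooth_on_continuous[OF smooth_on_directional[OF Q]] sub] .
  then have "bounded (G ` ?T)" using C(1) 
    by (intro compact_imp_bounded compact_continuous_image compact_Times) auto
  then obtain B where B: "\<And>z. z \<in> ?T \<Longrightarrow> norm (G z) \<le> B" by (auto simp: bounded_iff)
  have "norm (Q (s, x) - Q (0, x)) \<le> B * norm (s - 0)" if s: "s \<in> {-\<epsilon>/2..\<epsilon>/2}" and x: "x \<in> C" for s x
  proof (rule differentiable_bound[of "{-\<epsilon>/2..\<epsilon>/2}" "\<lambda>s. Q (s, x)" "\<lambda>s r. r *\<^sub>R G (s, x)"])
    fix s' assume s': "s' \<in> {-\<epsilon>/2..\<epsilon>/2}"
    then have m: "(s', x) \<in> {-\<epsilon><..<\<epsilon>} \<times> U" using x s' by (intro subsetD[OF sub]) simp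
    have "((\<lambda>s. Q (s, x)) has_vector_derivative G (s', x)) (at s')"
      unfolding G_def by (rule partial_derivatives(1)[OF smooth_on_differentiable[OF Q m]])
    then show "((\<lambda>s. Q (s, x)) has_derivative (\<lambda>r. r *\<^sub>R G (s', x))) (at s' within {-\<epsilon>/2..\<epsilon>/2})"
      unfolding has_vector_derivative_def by (rule has_derivative_at_withinI)
    show "onorm (\<lambda>r. r *\<^sub>R G (s', x)) \<le> B"
      using B[of "(s', x)"] s' x by (intro onorm_le) (auto simp: mult.commute[of B] intro!: mult_left_mono)
  qed (use s \<epsilon> in auto)
  moreover have "\<forall>\<^sub>F s in nhds 0. s \<in> {-\<epsilon>/2<..<\<epsilon>/2}"
    using \<epsilon> by (intro eventually_nhds_in_open) auto
  ultimately show thesis by (intro that[of B]) (auto elim!: eventually_mono)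
qed

lemma lipschitz_at_0_smooth:
  fixes Q :: "real \<times> 'a::real_normed_vector \<Rightarrow> 'b::real_normed_vector"
  assumes Q: "smooth_on ({-\<epsilon><..<\<epsilon>} \<times> U) Q" and \<epsilon>: "\<epsilon> > 0" and C: "compact C" "C \<subseteq> U"
  shows "lipschitz_at_0 C (\<lambda>s x. Q (s, x))"
proof -
  have "continuous_on C (\<lambda>x. Q (0, x))"
    using \<epsilon> C by (intro continuous_on_compose2[OF smooth_on_continuous[OF Q]] continuous_intros) auto
  then have "bounded ((\<lambda>x. Q (0, x)) ` C)" using C by (intro compact_imp_bounded compact_continuous_image)
  moreover obtain B where "\<forall>\<^sub>F s in nhds 0. \<forall>x\<in>C. norm (Q (s, x) - Q (0, x)) \<le> B * \<bar>s\<bar>"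
    using uniform_Lipschitz_in_parameter[OF Q \<epsilon> C] by blast
  ultimately show ?thesis unfolding lipschitz_at_0_def by blast
qed

lemma lipschitz_at_0_of_has_vector_derivative:
  fixes g :: "real \<Rightarrow> 'b::real_normed_vector"
  assumes "(g has_vector_derivative g') (at 0)"
  shows "\<forall>\<^sub>F s in nhds 0. norm (g s - g 0) \<le> (norm g' + 1) * \<bar>s\<bar>"
proof -
  have "((\<lambda>s. (g s - g 0 - s *\<^sub>R g') /\<^sub>R norm s) \<longlongrightarrow> 0) (at 0)"
    using assms unfolding has_vector_derivative_def has_derivative_at_within by simp
  then have "\<forall>\<^sub>F s in at 0. norm ((g s - g 0 - s *\<^sub>R g') /\<^sub>R norm s) < 1"
    by (auto simp: tendsto_iff dest!: spec[of _ 1])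
  then have "\<forall>\<^sub>F s in at 0. norm (g s - g 0) \<le> (norm g' + 1) * \<bar>s\<bar>"
    using eventually_neq_at_within[of 0 0 UNIV]
  proof eventually_elim
    case (elim s)
    then have s: "\<bar>s\<bar> > 0" by auto
    have "norm (g s - g 0 - s *\<^sub>R g') / \<bar>s\<bar> < 1"
      using elim(1) unfolding norm_scaleR by (simp add: divide_inverse_commute)
    then have "norm (g s - g 0 - s *\<^sub>R g') < \<bar>s\<bar>" using s by (simp add: divide_less_eq)
    moreover have "norm (g s - g 0) \<le> norm (g s - g 0 - s *\<^sub>R g') + norm (s *\<^sub>R g')"
      using norm_triangle_ineq[of "g s - g 0 - s *\<^sub>R g'" "s *\<^sub>R g'"] by simp
    ultimately show ?case by (simp add: algebra_simps)
  qed
  then show ?thesis by (auto simp: eventually_nhds_conv_at)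
qed

section \<open>Orthonormal frames and determinants\<close>

text \<open>In the Leibniz expansion a permutation \<open>\<sigma> \<noteq> id\<close> moves at least two indices, so its product has at least
  two factors that vanish at \<open>a\<close> and contributes nothing to the derivative.\<close>

lemma has_real_derivative_det_at_identity:
  fixes P :: "real \<Rightarrow> real ^ 'n ^ 'n"
  assumes P0: "P a = mat 1" 
    and der: "\<And>i j. ((\<lambda>s. P s $ i $ j) has_real_derivative P' i j) (at a)"
  shows "((\<lambda>s. det (P s)) has_real_derivative (\<Sum>i\<in>UNIV. P' i i)) (at a)"
proof -
  have pr: "((\<lambda>s. of_int (sign \<sigma>) * (\<Prod>i\<in>UNIV. P s $ i $ \<sigma> i)) has_real_derivative
      (if \<sigma> = id then \<Sum>i\<in>UNIV. P' i i else 0)) (at a)" if \<sigma>: "\<sigma> permutes UNIV" for \<sigma>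
  proof -
    have "((\<lambda>s. of_int (sign \<sigma>) * (\<Prod>i\<in>UNIV. P s $ i $ \<sigma> i)) has_real_derivative
      of_int (sign \<sigma>) * (\<Sum>i\<in>UNIV. P' i (\<sigma> i) * (\<Prod>j\<in>UNIV - {i}. P a $ j $ \<sigma> j))) (at a)"
      by (intro DERIV_cmult has_field_derivative_prod der)
    moreover have e: "P' i (\<sigma> i) * (\<Prod>j\<in>UNIV - {i}. P a $ j $ \<sigma> j) = (if \<sigma> = id then P' i i else 0)" for i
    proof (cases "\<sigma> = id")
      case False
      then obtain k where k: "\<sigma> k \<noteq> k" by (auto simp: fun_eq_iff)
      obtain j where j: "\<sigma> j \<noteq> j" "j \<noteq> i"
      proof (cases "k = i")
        case True
        have "\<sigma> (\<sigma> k) \<noteq> \<sigma> k" using k permutes_inj[OF \<sigma>] by (auto dest: injD)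
        then show thesis using that[of "\<sigma> k"] k True by auto
      qed (use k that in auto)
      have "P a $ j $ \<sigma> j = 0" using j by (auto simp: P0 mat_def)
      then have "(\<Prod>j\<in>UNIV - {i}. P a $ j $ \<sigma> j) = 0" using j by (intro prod_zero) auto
      then show ?thesis using False by simp
    qed (simp add: P0 mat_def)
    ultimately show ?thesis unfolding e by (cases "\<sigma> = id") simp_all
  qed
  have "((\<lambda>s. \<Sum>\<sigma> | \<sigma> permutes UNIV. of_int (sign \<sigma>) * (\<Prod>i\<in>UNIV. P s $ i $ \<sigma> i)) has_real_derivative
     (\<Sum>\<sigma> | \<sigma> permutes (UNIV :: 'n set). if \<sigma> = id then \<Sum>i\<in>UNIV. P' i i else 0)) (at a)"
    using pr by (intro DERIV_sum) auto
  also have "(\<Sum>\<sigma> | \<sigma> permutes (UNIV :: 'n set). if \<sigma> = id then \<Sum>i\<in>UNIV. P' i i else 0) = (\<Sum>i\<in>UNIV. P' i i)"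
    by (subst sum.delta) (auto simp: permutes_id)
  finally show ?thesis by (simp add: det_def)
qed

lemma linear_basis_expansion:
  fixes L :: "real ^ 'n::finite \<Rightarrow> 'v::real_vector"
  assumes "linear L"
  shows "L v = (\<Sum>k\<in>UNIV. v $ k *\<^sub>R L (axis k 1))"
proof -
  have "v = (\<Sum>k\<in>UNIV. v $ k *\<^sub>R axis k 1)"
    unfolding scalar_mult_eq_scaleR[symmetric] by (rule basis_expansion[symmetric])
  then have "L v = L (\<Sum>k\<in>UNIV. v $ k *\<^sub>R axis k 1)" by (rule arg_cong[where f = L])
  also have "\<dots> = (\<Sum>k\<in>UNIV. v $ k *\<^sub>R L (axis k 1))"
    using assms by (simp add: linear_sum linear_cmul)
  finally show ?thesis .
qed

text \<open>The Gram-type matrix of two linear maps, transformed by the matrix with columns \<open>e\<^sub>i\<close>, has the values on the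
  vectors \<open>e\<^sub>i\<close> as entries.\<close>

lemma congruence_entries:
  fixes K L :: "real ^ 'n::finite \<Rightarrow> 'v::real_inner" and e :: "'n \<Rightarrow> real ^ 'n"
  assumes "linear K" "linear L"
  defines "E \<equiv> (\<chi> k i. e i $ k)"
  shows "(transpose E ** (\<chi> k l. K (axis k 1) \<bullet> L (axis l 1)) ** E) $ i $ j = K (e i) \<bullet> L (e j)"
  unfolding linear_basis_expansion[OF assms(1), of "e i"] linear_basis_expansion[OF assms(2), of "e j"]
  by (simp add: E_def matrix_matrix_mult_def transpose_def inner_sum_left inner_sum_right sum_distrib_right
       mult.commute mult.left_commute)

text \<open>The condition of \<open>orthonormal_frame\<close> for an abstract linear map in place of the differential of an
  immersion.\<close>

definition orthonormal_images :: "(real ^ 'n::finite \<Rightarrow> 'v::real_inner) \<Rightarrow> ('n \<Rightarrow> real ^ 'n) \<Rightarrow> bool" where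
  "orthonormal_images L e \<longleftrightarrow> (\<forall>i j. L (e i) \<bullet> L (e j) = (if i = j then 1 else 0))"

lemma orthonormal_images_matrix:
  fixes L :: "real ^ 'n::finite \<Rightarrow> 'v::real_inner"
  assumes "linear L" "orthonormal_images L e"
  defines "E \<equiv> (\<chi> k i. e i $ k)" and "G \<equiv> (\<chi> k l. L (axis k 1) \<bullet> L (axis l 1))"
  shows "transpose E ** G ** E = mat 1" "(E ** transpose E) ** G = mat 1" "G ** (E ** transpose E) = mat 1"
    "det E * det E * det G = 1"
proof -
  show 1: "transpose E ** G ** E = mat 1"
    using congruence_entries[OF assms(1,1), of e] assms(2)
    by (simp add: vec_eq_iff E_def G_def mat_def orthonormal_images_def)
  then have "E ** (transpose E ** G) = mat 1" by (simp add: matrix_left_right_inverse)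
  then show 2: "(E ** transpose E) ** G = mat 1" by (simp add: matrix_mul_assoc)
  then show "G ** (E ** transpose E) = mat 1" by (simp add: matrix_left_right_inverse)
  have "det (transpose E ** G ** E) = 1" using 1 by simp
  then show "det E * det E * det G = 1" by (simp add: det_mul det_transpose mult_ac)
qed

text \<open>With \<open>E\<close> the matrix with columns \<open>e\<^sub>i\<close> and \<open>G\<close> the Gram matrix of \<open>L\<close>, the sum is the trace of
  \<open>B E E\<^sup>T\<close>, and orthonormality forces \<open>E E\<^sup>T = G\<^sup>-\<^sup>1\<close>, which does not depend on the frame.\<close>

lemma trace_over_orthonormal_images:
  fixes K L :: "real ^ 'n::finite \<Rightarrow> 'v::real_inner"
  assumes K: "linear K" and L: "linear L" and e: "orthonormal_images L e" and e': "orthonormal_images L e'"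
  shows "(\<Sum>i\<in>UNIV. K (e i) \<bullet> L (e i)) = (\<Sum>i\<in>UNIV. K (e' i) \<bullet> L (e' i))"
proof -
  define B :: "real ^ 'n ^ 'n" where "B = (\<chi> k l. K (axis k 1) \<bullet> L (axis l 1))"
  define G :: "real ^ 'n ^ 'n" where "G = (\<chi> k l. L (axis k 1) \<bullet> L (axis l 1))"
  define E where "E e = (\<chi> k i. e i $ k)" for e :: "'n \<Rightarrow> real ^ 'n"
  have tr: "(\<Sum>i\<in>UNIV. K (e i) \<bullet> L (e i)) = trace (B ** (E e ** transpose (E e)))" for e
  proof -
    have "(\<Sum>i\<in>UNIV. K (e i) \<bullet> L (e i)) = trace (transpose (E e) ** B ** E e)"
      using congruence_entries[OF K L, of e] by (simp add: trace_def E_def B_def)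
    also have "\<dots> = trace (transpose (E e) ** (B ** E e))" by (simp add: matrix_mul_assoc)
    also have "\<dots> = trace ((B ** E e) ** transpose (E e))" by (rule trace_mul_sym)
    finally show ?thesis by (simp add: matrix_mul_assoc)
  qed
  have "E e ** transpose (E e) = E e ** transpose (E e) ** (G ** (E e' ** transpose (E e')))"
    using orthonormal_images_matrix(3)[OF L e'] by (simp add: E_def G_def)
  also have "\<dots> = (E e ** transpose (E e) ** G) ** (E e' ** transpose (E e'))"
    by (simp add: matrix_mul_assoc)
  also have "\<dots> = E e' ** transpose (E e')"
    using orthonormal_images_matrix(2)[OF L e] by (simp add: E_def G_def)
  finally show ?thesis unfolding tr by simp
qed

text \<open>Pull an orthonormal basis of the range of \<open>L\<close> back along \<open>L\<close>.\<close>

lemma orthonormal_images_exist: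
  fixes L :: "real ^ 'n::finite \<Rightarrow> 'v::euclidean_space"
  assumes L: "linear L" "inj L"
  obtains e where "orthonormal_images L e"
proof -
  have sub: "subspace (range L)" using L(1) by (simp add: linear_subspace_image)
  obtain B where B: "B \<subseteq> range L" "pairwise orthogonal B" "\<And>x. x \<in> B \<Longrightarrow> norm x = 1"
     "independent B" "card B = dim (range L)"
    using orthonormal_basis_subspace[OF sub] by metis
  have "dim (range L) = CARD('n)" using dim_image_eq[OF L(1)] L(2) by (simp add: inj_on_subset)
  moreover have "finite B" using B(4) by (rule independent_imp_finite)
  ultimately obtain b :: "'n \<Rightarrow> 'v" where b: "bij_betw b UNIV B"
    using B(5) finite_same_card_bij[of "UNIV :: 'n set" B] by auto
  have bB: "b i \<in> B" for i using b by (auto simp: bij_betw_def)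
  have L': "L (inv L (b i)) = b i" for i using bB B(1) by (meson f_inv_into_f subsetD)
  show thesis
  proof (rule that[of "\<lambda>i. inv L (b i)"], unfold orthonormal_images_def L', intro allI)
    fix i j
    show "b i \<bullet> b j = (if i = j then 1 else 0)"
    proof (cases "i = j")
      case True then show ?thesis using B(3)[OF bB[of j]] by (simp add: norm_eq_1)
    next
      case False
      then have "b i \<noteq> b j" using b by (auto simp: bij_betw_def dest: injD)
      then show ?thesis using B(2) bB False by (auto simp: pairwise_def orthogonal_def)
    qed
  qed
qed

section \<open>Charts\<close>

lemma chart_basics:
  assumes "is_chart M c"
  shows "fst c \<subseteq> topspace M" "openin M (fst c)" "inj_on (snd c) (fst c)" "open (snd c ` fst c)"
    and "\<And>p. p \<in> fst c \<Longrightarrow> chart_inv c (snd c p) = p"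
    and "\<And>x. x \<in> snd c ` fst c \<Longrightarrow> snd c (chart_inv c x) = x"
    and "\<And>x. x \<in> snd c ` fst c \<Longrightarrow> chart_inv c x \<in> fst c"
    and "continuous_map (subtopology M (fst c)) euclidean (snd c)"
    and "continuous_map (top_of_set (snd c ` fst c)) (subtopology M (fst c)) (chart_inv c)"
proof -
  show o: "openin M (fst c)" and "open (snd c ` fst c)" using assms by (auto simp: is_chart_def)
  then show sub: "fst c \<subseteq> topspace M" by (simp add: openin_subset)
  have h: "homeomorphic_map (subtopology M (fst c)) (top_of_set (snd c ` fst c)) (snd c)"
    using assms by (auto simp: is_chart_def)
  have t: "topspace (subtopology M (fst c)) = fst c" using sub by auto
  show inj: "inj_on (snd c) (fst c)" using homeomorphic_imp_injective_map[OF h] t by simp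
  show i1: "\<And>p. p \<in> fst c \<Longrightarrow> chart_inv c (snd c p) = p" using inj by simp
  show i2: "\<And>x. x \<in> snd c ` fst c \<Longrightarrow> snd c (chart_inv c x) = x" by (rule f_inv_into_f)
  show i3: "\<And>x. x \<in> snd c ` fst c \<Longrightarrow> chart_inv c x \<in> fst c" by (rule inv_into_into)
  show "continuous_map (subtopology M (fst c)) euclidean (snd c)"
    using homeomorphic_imp_continuous_map[OF h] continuous_map_in_subtopology by blast
  obtain g where g: "homeomorphic_maps (subtopology M (fst c)) (top_of_set (snd c ` fst c)) (snd c) g"
    using h homeomorphic_map_maps by blast
  show "continuous_map (top_of_set (snd c ` fst c)) (subtopology M (fst c)) (chart_inv c)"
  proof (rule continuous_map_eq)
    show "continuous_map (top_of_set (snd c ` fst c)) (subtopology M (fst c)) g"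
      using g by (simp add: homeomorphic_maps_def)
    fix x assume "x \<in> topspace (top_of_set (snd c ` fst c))"
    then obtain p where p: "p \<in> fst c" "x = snd c p" by auto
    then show "g x = chart_inv c x" using g i1 t by (auto simp: homeomorphic_maps_def)
  qed
qed

lemma chart_image_open:
  assumes c: "is_chart M c" and W: "openin M W"
  shows "open (snd c ` (fst c \<inter> W))"
proof -
  have "homeomorphic_map (subtopology M (fst c)) (top_of_set (snd c ` fst c)) (snd c)"
    using c by (simp add: is_chart_def)
  then have "open_map (subtopology M (fst c)) (top_of_set (snd c ` fst c)) (snd c)"
    by (rule homeomorphic_imp_open_map)
  moreover have "openin (subtopology M (fst c)) (fst c \<inter> W)"
    using W by (auto simp: openin_subtopology Int_commute)
  ultimately have "openin (top_of_set (snd c ` fst c)) (snd c ` (fst c \<inter> W))" by (simp add: open_map_def)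
  then show ?thesis using chart_basics(4)[OF c] openin_open_trans by blast
qed

lemma continuous_map_chart:
  assumes c: "is_chart M c" and k: "continuous_on (snd c ` fst c) k"
  shows "continuous_map (subtopology M (fst c)) euclidean (\<lambda>p. k (snd c p))"
proof -
  have "continuous_map (subtopology M (fst c)) (top_of_set (snd c ` fst c)) (snd c)"
    using chart_basics(8)[OF c] by (auto simp: continuous_map_in_subtopology)
  from continuous_map_compose[OF this, of euclidean k] k show ?thesis
    by (simp add: o_def)
qed

lemma continuous_map_from_charts:
  assumes A: "\<And>c. c \<in> A \<Longrightarrow> is_chart M c" "(\<Union>c\<in>A. fst c) = topspace M"
    and Y: "\<And>c. c \<in> A \<Longrightarrow> continuous_on (snd c ` fst c) (Y \<circ> chart_inv c)"
  shows "continuous_map M euclidean Y"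
proof (rule pasting_lemma[where I = A and T = fst and f = "\<lambda>_. Y"])
  fix c assume c: "c \<in> A"
  show "openin M (fst c)" using chart_basics(2) A c by blast
  have "continuous_map (subtopology M (fst c)) euclidean (\<lambda>p. (Y \<circ> chart_inv c) (snd c p))"
    by (rule continuous_map_chart[OF A(1)[OF c] Y[OF c]])
  then show "continuous_map (subtopology M (fst c)) euclidean Y"
    by (rule continuous_map_eq) (use chart_basics(5)[OF A(1)[OF c]] in auto)
qed (use A(2) in \<open>blast+\<close>)

lemma smooth_map_chart_differentiable:
  assumes "smooth_map A Y" "c \<in> A" "p \<in> fst c"
  shows "(Y \<circ> chart_inv c) differentiable (at (snd c p))" "linear (chart_deriv c Y p)"
    "((Y \<circ> chart_inv c) has_derivative chart_deriv c Y p) (at (snd c p))"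
proof -
  show *: "(Y \<circ> chart_inv c) differentiable (at (snd c p))"
    using assms by (auto simp: smooth_map_def intro: smooth_on_differentiable)
  then show "linear (chart_deriv c Y p)" unfolding chart_deriv_def by (rule linear_frechet_derivative)
  show "((Y \<circ> chart_inv c) has_derivative chart_deriv c Y p) (at (snd c p))"
    using * unfolding chart_deriv_def by (simp add: frechet_derivative_works)
qed

lemma chart_deriv_local:
  assumes c: "is_chart M c" and W: "openin M W" "p \<in> fst c" "p \<in> W" and eq: "\<And>q. q \<in> W \<Longrightarrow> Y q = Z q"
    and Y: "(Y \<circ> chart_inv c) differentiable (at (snd c p))"
  shows "chart_deriv c Y p = chart_deriv c Z p"
proof -
  have "((Y \<circ> chart_inv c) has_derivative chart_deriv c Y p) (at (snd c p))"
    using Y unfolding chart_deriv_def by (simp add: frechet_derivative_works)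
  then have "((Z \<circ> chart_inv c) has_derivative chart_deriv c Y p) (at (snd c p))"
    by (rule has_derivative_transform_within_open[OF _ chart_image_open[OF c W(1)]])
       (use W eq chart_basics(5)[OF c] in auto)
  then show ?thesis unfolding chart_deriv_def[of c Z] using frechet_derivative_at by metis
qed

text \<open>Chain rule for the transition map. The differentials of all maps on \<open>M\<close> transform by the same linear
  map, so a frame can be carried from one chart to the other for \<open>X\<close> and \<open>N\<close> at once.\<close>

lemma chart_deriv_change:
  fixes Y :: "'a \<Rightarrow> 'v::real_normed_vector" and A :: "('a, 'n::finite) chart set"
  assumes M: "smooth_manifold M A" and Y: "smooth_map A Y" and c: "c \<in> A" "p \<in> fst c" and d: "d \<in> A" "p \<in> fst d"
  shows "chart_deriv d Y p v = chart_deriv c Y p (frechet_derivative (snd c \<circ> chart_inv d) (at (snd d p)) v)"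
proof -
  have ch: "is_chart M c" "is_chart M d" using M c d by (auto simp: smooth_manifold_def)
  let ?T = "frechet_derivative (snd c \<circ> chart_inv d) (at (snd d p))"
  let ?W = "snd d ` (fst d \<inter> fst c)"
  have W: "open ?W"
    using chart_image_open[OF ch(2) chart_basics(2)[OF ch(1)]] by (simp add: Int_commute)
  have "smooth_on ?W (snd c \<circ> chart_inv d)" using M c d by (auto simp: smooth_manifold_def)
  then have "(snd c \<circ> chart_inv d) differentiable (at (snd d p))"
    by (rule smooth_on_differentiable) (use c d in auto)
  then have 1: "((snd c \<circ> chart_inv d) has_derivative ?T) (at (snd d p))"
    by (simp add: frechet_derivative_works)
  have pp: "(snd c \<circ> chart_inv d) (snd d p) = snd c p" using chart_basics(5)[OF ch(2) d(2)] by simp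
  have "(Y \<circ> chart_inv c) differentiable (at (snd c p))"
    using Y c by (auto simp: smooth_map_def intro: smooth_on_differentiable)
  then have 2: "((Y \<circ> chart_inv c) has_derivative chart_deriv c Y p) (at ((snd c \<circ> chart_inv d) (snd d p)))"
    unfolding pp chart_deriv_def by (simp add: frechet_derivative_works)
  have "((\<lambda>x. (Y \<circ> chart_inv c) ((snd c \<circ> chart_inv d) x)) has_derivative (\<lambda>v. chart_deriv c Y p (?T v))) (at (snd d p))"
    by (rule has_derivative_compose[OF 1 2])
  then have "((Y \<circ> chart_inv d) has_derivative (\<lambda>v. chart_deriv c Y p (?T v))) (at (snd d p))"
    by (rule has_derivative_transform_within_open[OF _ W])
       (use c d chart_basics(5)[OF ch(1)] chart_basics(5)[OF ch(2)] in auto)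
  then show ?thesis unfolding chart_deriv_def[of d] using frechet_derivative_at by metis
qed

text \<open>The differential of the single map \<open>X s\<close> is a partial derivative of the family, which makes it smooth in
  both variables together.\<close>

lemma chart_deriv_eq_partial:
  fixes X :: "real \<Rightarrow> 'a \<Rightarrow> 'v::real_normed_vector"
  assumes "smooth_on (I \<times> snd c ` fst c) (\<lambda>(s, x). X s (chart_inv c x))" "s \<in> I" "p \<in> fst c"
  shows "chart_deriv c (X s) p v = frechet_derivative (\<lambda>(s, x). X s (chart_inv c x)) (at (s, snd c p)) (0, v)"
    and "(X s \<circ> chart_inv c) differentiable (at (snd c p))"
proof -
  let ?F = "\<lambda>(s, x). X s (chart_inv c x)"
  have "?F differentiable (at (s, snd c p))"
    by (rule smooth_on_differentiable[OF assms(1)]) (use assms(2,3) in auto)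
  from partial_derivatives(2)[OF this]
  have *: "((X s \<circ> chart_inv c) has_derivative (\<lambda>v. frechet_derivative ?F (at (s, snd c p)) (0, v))) (at (snd c p))"
    by (simp add: o_def)
  from * show "(X s \<circ> chart_inv c) differentiable (at (snd c p))" by (rule differentiableI)
  show "chart_deriv c (X s) p v = frechet_derivative ?F (at (s, snd c p)) (0, v)"
    unfolding chart_deriv_def using frechet_derivative_at[OF *] by metis
qed

lemma smooth_family_in_chart:
  fixes X :: "real \<Rightarrow> 'a \<Rightarrow> 'v::euclidean_space"
  assumes X: "smooth_family A {-\<epsilon><..<\<epsilon>} X" and c: "c \<in> A" "is_chart M c" and \<epsilon>: "\<epsilon> > 0"
    and C: "compact C" "C \<subseteq> snd c ` fst c"
  shows "lipschitz_at_0 C (\<lambda>s x. X s (chart_inv c x))"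
    and "lipschitz_at_0 C (\<lambda>s x. det (metric_matrix c (X s) (chart_inv c x)))"
    and "\<And>s. s \<in> {-\<epsilon><..<\<epsilon>} \<Longrightarrow> continuous_on (snd c ` fst c) (X s \<circ> chart_inv c)"
    and "\<And>s. s \<in> {-\<epsilon><..<\<epsilon>} \<Longrightarrow> continuous_on (snd c ` fst c) (\<lambda>x. det (metric_matrix c (X s) (chart_inv c x)))"
proof -
  let ?F = "\<lambda>(s, x). X s (chart_inv c x)"
  let ?I = "{-\<epsilon><..<\<epsilon>}" let ?V = "snd c ` fst c"
  have F: "smooth_on (?I \<times> ?V) ?F" using X c(1) by (auto simp: smooth_family_def)
  define E where "E i z = frechet_derivative ?F (at z) (0, axis i 1)" for i z
  have E: "smooth_on (?I \<times> ?V) (E i)" for i unfolding E_def by (rule smooth_on_directional[OF F])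
  have m: "metric_matrix c (X s) (chart_inv c x) = (\<chi> i j. E i (s, x) \<bullet> E j (s, x))" if "s \<in> ?I" "x \<in> ?V" for s x
    using chart_deriv_eq_partial(1)[of ?I c X s "chart_inv c x"] F that chart_basics(6,7)[OF c(2)]
    by (simp add: metric_matrix_def E_def)
  show "lipschitz_at_0 C (\<lambda>s x. X s (chart_inv c x))"
    using lipschitz_at_0_smooth[OF F \<epsilon> C] by simp
  have L: "lipschitz_at_0 C (\<lambda>s x. det (\<chi> i j. E i (s, x) \<bullet> E j (s, x)))"
    by (rule lipschitz_at_0_det) (simp add: lipschitz_at_0_inner lipschitz_at_0_smooth[OF E \<epsilon> C])
  have ev: "\<forall>\<^sub>F s in nhds 0. s \<in> ?I" using \<epsilon> by (intro eventually_nhds_in_open) auto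
  show "lipschitz_at_0 C (\<lambda>s x. det (metric_matrix c (X s) (chart_inv c x)))"
  proof -
    have 0: "det (metric_matrix c (X 0) (chart_inv c x)) = det (\<chi> i j. E i (0, x) \<bullet> E j (0, x))" if "x \<in> C" for x
      using m[of 0 x] \<epsilon> that C by auto
    obtain B where B: "\<forall>\<^sub>F s in nhds 0. \<forall>x\<in>C. norm (det (\<chi> i j. E i (s, x) \<bullet> E j (s, x)) - det (\<chi> i j. E i (0, x) \<bullet> E j (0, x))) \<le> B * \<bar>s\<bar>"
      using L unfolding lipschitz_at_0_def by blast
    have "\<forall>\<^sub>F s in nhds 0. \<forall>x\<in>C. norm (det (metric_matrix c (X s) (chart_inv c x)) - det (metric_matrix c (X 0) (chart_inv c x))) \<le> B * \<bar>s\<bar>"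
      using B ev by eventually_elim (use C(2) in \<open>auto simp: m 0 subset_iff\<close>)
    moreover have "bounded ((\<lambda>x. det (metric_matrix c (X 0) (chart_inv c x))) ` C)"
      using L 0 unfolding lipschitz_at_0_def by (simp cong: image_cong)
    ultimately show ?thesis unfolding lipschitz_at_0_def by blast
  qed
  fix s assume s: "s \<in> ?I"
  show "continuous_on ?V (X s \<circ> chart_inv c)"
    using continuous_on_compose2[OF smooth_on_continuous[OF F], of ?V "\<lambda>x. (s, x)"] s 
    by (force simp: o_def intro!: continuous_intros)
  have Ec: "continuous_on ?V (\<lambda>x. E i (s, x))" for i
    by (rule continuous_on_compose2[OF smooth_on_continuous[OF E]]) (use s in \<open>auto intro!: continuous_intros\<close>)
  have "continuous_on ?V (\<lambda>x. det (\<chi> i j. E i (s, x) \<bullet> E j (s, x)))"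
    unfolding det_def by (auto intro!: continuous_intros Ec)
  then show "continuous_on ?V (\<lambda>x. det (metric_matrix c (X s) (chart_inv c x)))"
    by (rule continuous_on_eq) (use m s in auto)
qed

section \<open>Mean curvature\<close>

text \<open>A frame in any other chart is carried to a frame in \<open>c\<close> by the transition map, without changing the values of the
  second fundamental form; within \<open>c\<close> the trace is independent of the frame. The existence of at least one
  frame is what makes the definite description unique.\<close>

lemma mean_curvature_eq_trace:
  fixes A :: "('a, 'n::finite) chart set" and X :: "'a \<Rightarrow> 'v::real_inner"
  assumes M: "smooth_manifold M A" and X: "smooth_map A X" and N: "smooth_map A N"
    and c: "c \<in> A" "p \<in> fst c" and e: "orthonormal_frame c X p e"
  shows "mean_curvature A X N p = (\<Sum>i\<in>UNIV. second_fundamental_form c X N p (e i) (e i))"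
proof -
  have *: "(\<Sum>i\<in>UNIV. second_fundamental_form d X N p (a i) (a i)) = (\<Sum>i\<in>UNIV. second_fundamental_form c X N p (e i) (e i))"
    if d: "d \<in> A" "p \<in> fst d" and a: "orthonormal_frame d X p a" for d a
  proof -
    let ?T = "frechet_derivative (snd c \<circ> chart_inv d) (at (snd d p))"
    note ch = chart_deriv_change[OF M X c d] chart_deriv_change[OF M N c d]
    have "orthonormal_images (chart_deriv c X p) (\<lambda>i. ?T (a i))"
      using a unfolding orthonormal_images_def orthonormal_frame_def ch by simp
    moreover have "orthonormal_images (chart_deriv c X p) e"
      using e unfolding orthonormal_images_def orthonormal_frame_def by simp
    ultimately have "(\<Sum>i\<in>UNIV. chart_deriv c N p (?T (a i)) \<bullet> chart_deriv c X p (?T (a i)))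
        = (\<Sum>i\<in>UNIV. chart_deriv c N p (e i) \<bullet> chart_deriv c X p (e i))"
      by (rule trace_over_orthonormal_images[OF smooth_map_chart_differentiable(2)[OF N c]
            smooth_map_chart_differentiable(2)[OF X c]])
    then show ?thesis by (simp add: second_fundamental_form_def ch sum_negf)
  qed
  show ?thesis unfolding mean_curvature_def
  proof (rule the_equality)
    fix H
    assume "\<forall>c\<in>A. p \<in> fst c \<longrightarrow> (\<forall>e. orthonormal_frame c X p e \<longrightarrow>
      H = (\<Sum>i\<in>UNIV. second_fundamental_form c X N p (e i) (e i)))"
    then show "H = (\<Sum>i\<in>UNIV. second_fundamental_form c X N p (e i) (e i))" using c e by blast
  next
    show "\<forall>d\<in>A. p \<in> fst d \<longrightarrow> (\<forall>a. orthonormal_frame d X p a \<longrightarrow>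
      (\<Sum>i\<in>UNIV. second_fundamental_form c X N p (e i) (e i))
        = (\<Sum>i\<in>UNIV. second_fundamental_form d X N p (a i) (a i)))"
      by (intro ballI impI allI) (rule *[symmetric])
  qed
qed

section \<open>First variation of the area density\<close>

text \<open>For an orthonormal frame with matrix \<open>E\<close> the identity \<open>E\<^sup>T G E = 1\<close> gives \<open>(det E)\<^sup>2 det G = 1\<close>.\<close>

lemma immersion_metric_det_pos:
  fixes X :: "'a \<Rightarrow> 'v::euclidean_space" and A :: "('a, 'n::finite) chart set"
  assumes X: "immersion A X" and c: "c \<in> A" "p \<in> fst c"
  shows "det (metric_matrix c X p) > 0"
proof -
  have X': "smooth_map A X" "inj (chart_deriv c X p)" using X c by (auto simp: immersion_def)
  note L = smooth_map_chart_differentiable(2)[OF X'(1) c]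
  obtain e where e: "orthonormal_images (chart_deriv c X p) e"
    using orthonormal_images_exist[OF L X'(2)] .
  have "det (\<chi> k i. e i $ k) * det (\<chi> k i. e i $ k) * det (metric_matrix c X p) = 1"
    using orthonormal_images_matrix(4)[OF L e] by (simp add: metric_matrix_def)
  then show ?thesis
    by (metis mult_nonneg_nonpos not_le not_one_le_zero zero_le_square)
qed

text \<open>This is \<open>\<partial>\<^sub>s dX = d(\<partial>\<^sub>s X) = d(f N)\<close>. The coefficient \<open>a\<close> is the derivative of \<open>f\<close> in direction \<open>v\<close>; it is
  left unspecified because it multiplies \<open>N\<close> and disappears against tangent vectors.\<close>

lemma derivative_of_tangent_vector:
  fixes X :: "real \<Rightarrow> 'a \<Rightarrow> 'v::euclidean_space" and A :: "('a, 'n::finite) chart set"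
  assumes c: "is_chart M c" "c \<in> A" and N: "unit_normal A (X 0) N"
    and \<epsilon>: "\<epsilon> > 0" and X: "smooth_family A {-\<epsilon><..<\<epsilon>} X"
    and var: "\<And>p. p \<in> topspace M \<Longrightarrow> ((\<lambda>s. X s p) has_vector_derivative f p *\<^sub>R N p) (at 0)"
    and p: "p \<in> fst c"
  obtains a where "((\<lambda>s. chart_deriv c (X s) p v) has_vector_derivative f p *\<^sub>R chart_deriv c N p v + a *\<^sub>R N p) (at 0)"
proof -
  let ?F = "\<lambda>(s, x). X s (chart_inv c x)" let ?I = "{-\<epsilon><..<\<epsilon>}" let ?V = "snd c ` fst c"
  let ?x = "snd c p"
  note cb = chart_basics[OF c(1)]
  have F: "smooth_on (?I \<times> ?V) ?F" using X c(2) by (auto simp: smooth_family_def)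
  have IV: "open (?I \<times> ?V)" using cb(4) by (intro open_Times) auto
  have 0: "0 \<in> ?I" using \<epsilon> by auto
  define D where "D w z = frechet_derivative ?F (at z) w" for w z
  have D: "smooth_on (?I \<times> ?V) (D w)" for w unfolding D_def by (rule smooth_on_directional[OF F])
  have px: "(0, ?x) \<in> ?I \<times> ?V" using 0 p by auto
  note Dd = smooth_on_differentiable[OF D px]
  have "((\<lambda>s. D (0, v) (s, ?x)) has_vector_derivative frechet_derivative (D (0, v)) (at (0, ?x)) (1, 0)) (at 0)"
    by (rule partial_derivatives(1)[OF Dd])
  then have "((\<lambda>s. chart_deriv c (X s) p v) has_vector_derivative frechet_derivative (D (0, v)) (at (0, ?x)) (1, 0)) (at 0)"
    by (rule has_vector_derivative_transform_within_open[of _ _ _ ?I])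
       (use 0 chart_deriv_eq_partial(1)[of ?I c X, OF F] p in \<open>auto simp: D_def\<close>)
  moreover have "frechet_derivative (D (0, v)) (at (0, ?x)) (1, 0) = frechet_derivative (D (1, 0)) (at (0, ?x)) (0, v)"
    unfolding D_def by (rule mixed_derivatives_commute[OF F IV px])
  moreover obtain a where "frechet_derivative (D (1, 0)) (at (0, ?x)) (0, v) = f p *\<^sub>R chart_deriv c N p v + a *\<^sub>R N p"
  proof -
    define g where "g x = D (1, 0) (0, x)" for x
    have N': "smooth_map A N" "\<And>q. q \<in> fst c \<Longrightarrow> N q \<bullet> N q = 1" 
      using N c(2) by (auto simp: unit_normal_def norm_eq_1)
    have gN: "g x = f (chart_inv c x) *\<^sub>R N (chart_inv c x)" if "x \<in> ?V" for x
    proof -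
      have "?F differentiable (at (0, x))" by (rule smooth_on_differentiable[OF F]) (use 0 that in auto)
      from partial_derivatives(1)[OF this]
      have "((\<lambda>s. X s (chart_inv c x)) has_vector_derivative g x) (at 0)" by (simp add: g_def D_def)
      moreover have "chart_inv c x \<in> topspace M" using cb(1) cb(7)[OF that] by blast
      ultimately show ?thesis using var vector_derivative_unique_at by blast
    qed
    have dg: "(g has_derivative (\<lambda>v. frechet_derivative (D (1, 0)) (at (0, ?x)) (0, v))) (at ?x)" (is "(_ has_derivative ?w) _")
      unfolding g_def by (rule partial_derivatives(2)[OF Dd])
    have dN: "((\<lambda>x. N (chart_inv c x)) has_derivative chart_deriv c N p) (at ?x)"
      using smooth_map_chart_differentiable(3)[OF N'(1) c(2) p] by (simp add: o_def)
    \<comment> \<open>Differentiability of \<open>f\<close> in the chart comes from \<open>f = \<langle>\<partial>\<^sub>s X, N\<rangle>\<close>, which holds because \<open>\<bar>N\<bar> = 1\<close>.\<close>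
    define k where "k x = g x \<bullet> N (chart_inv c x)" for x
    obtain k' where dk: "(k has_derivative k') (at ?x)"
      using has_derivative_inner[OF dg dN] unfolding k_def by blast
    have kf: "k x = f (chart_inv c x)" if "x \<in> ?V" for x
      unfolding k_def gN[OF that] using N'(2)[OF cb(7)[OF that]] by simp
    have "((\<lambda>x. k x *\<^sub>R N (chart_inv c x)) has_derivative 
       (\<lambda>v. k ?x *\<^sub>R chart_deriv c N p v + k' v *\<^sub>R N (chart_inv c ?x))) (at ?x)"
      by (rule has_derivative_scaleR[OF dk dN])
    then have "(g has_derivative 
       (\<lambda>v. k ?x *\<^sub>R chart_deriv c N p v + k' v *\<^sub>R N (chart_inv c ?x))) (at ?x)"
      by (rule has_derivative_transform_within_open[OF _ cb(4)]) (use p gN kf in auto)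
    then have "?w = (\<lambda>v. k ?x *\<^sub>R chart_deriv c N p v + k' v *\<^sub>R N (chart_inv c ?x))"
      by (rule has_derivative_unique[OF dg])
    then have "?w v = k ?x *\<^sub>R chart_deriv c N p v + k' v *\<^sub>R N (chart_inv c ?x)"
      by (rule fun_cong)
    moreover have "k ?x = f p" using kf[of ?x] p cb(5)[OF p] by auto
    ultimately have "?w v = f p *\<^sub>R chart_deriv c N p v + k' v *\<^sub>R N p"
      using cb(5)[OF p] by simp
    then show thesis by (rule that)
  qed
  ultimately show thesis using that by metis
qed

text \<open>In an orthonormal frame for \<open>X 0\<close> the ratio of determinants is the determinant of a matrix that equals the
  identity at \<open>s = 0\<close>.\<close>

lemma derivative_of_metric_det:
  fixes X :: "real \<Rightarrow> 'a \<Rightarrow> 'v::euclidean_space" and A :: "('a, 'n::finite) chart set"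
  assumes M: "smooth_manifold M A" and imm: "immersion A (X 0)" and N: "unit_normal A (X 0) N"
    and \<epsilon>: "\<epsilon> > 0" and X: "smooth_family A {-\<epsilon><..<\<epsilon>} X"
    and var: "\<And>p. p \<in> topspace M \<Longrightarrow> ((\<lambda>s. X s p) has_vector_derivative f p *\<^sub>R N p) (at 0)"
    and c: "c \<in> A" "p \<in> fst c"
  shows "((\<lambda>s. det (metric_matrix c (X s) p) / det (metric_matrix c (X 0) p)) has_real_derivative
     - 2 * f p * mean_curvature A (X 0) N p) (at 0)"
proof -
  have ch: "is_chart M c" using M c by (auto simp: smooth_manifold_def)
  let ?L = "\<lambda>s. chart_deriv c (X s) p" let ?K = "chart_deriv c N p" let ?I = "{-\<epsilon><..<\<epsilon>}"
  have X0: "smooth_map A (X 0)" "inj (?L 0)" using imm c by (auto simp: immersion_def)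
  have N': "smooth_map A N" "\<And>v. N p \<bullet> ?L 0 v = 0" using N c by (auto simp: unit_normal_def)
  have F: "smooth_on (?I \<times> snd c ` fst c) (\<lambda>(s, x). X s (chart_inv c x))" using X c(1) by (auto simp: smooth_family_def)
  have lin: "linear (?L s)" if "s \<in> ?I" for s
    unfolding chart_deriv_def using chart_deriv_eq_partial(2)[of ?I c X, OF F that c(2)] by (rule linear_frechet_derivative)
  have 0: "0 \<in> ?I" using \<epsilon> by auto
  obtain e where e: "orthonormal_images (?L 0) e" using orthonormal_images_exist[OF lin[OF 0] X0(2)] .
  define E :: "real ^ 'n ^ 'n" where "E = (\<chi> k i. e i $ k)"
  define P where "P s = transpose E ** metric_matrix c (X s) p ** E" for s
  have P: "P s $ i $ j = ?L s (e i) \<bullet> ?L s (e j)" if "s \<in> ?I" for s i j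
    using congruence_entries[OF lin[OF that] lin[OF that], of e i j] by (simp add: P_def E_def metric_matrix_def)
  have P0: "P 0 = mat 1"
    using orthonormal_images_matrix(1)[OF lin[OF 0] e] by (simp add: P_def E_def metric_matrix_def)
  have detE: "det E * det E * det (metric_matrix c (X 0) p) = 1"
    using orthonormal_images_matrix(4)[OF lin[OF 0] e] by (simp add: E_def metric_matrix_def)
  have detP: "det (P s) = det (metric_matrix c (X s) p) / det (metric_matrix c (X 0) p)" for s
  proof -
    have "det (P s) = det E * det E * det (metric_matrix c (X s) p)"
      by (simp add: P_def det_mul det_transpose mult_ac)
    moreover have "det E * det E = 1 / det (metric_matrix c (X 0) p)"
      using detE by (metis mult_zero_right nonzero_eq_divide_eq zero_neq_one)
    ultimately show ?thesis by simp
  qed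
  have "\<exists>a. ((\<lambda>s. ?L s (e i)) has_vector_derivative f p *\<^sub>R ?K (e i) + a *\<^sub>R N p) (at 0)" for i
    by (rule derivative_of_tangent_vector[of M c A X N \<epsilon> f p "e i"]) (use ch c N \<epsilon> X var in auto)
  then obtain a where a: "\<And>i. ((\<lambda>s. ?L s (e i)) has_vector_derivative f p *\<^sub>R ?K (e i) + a i *\<^sub>R N p) (at 0)"
    by metis
  define P' where "P' i j = ?L 0 (e i) \<bullet> (f p *\<^sub>R ?K (e j) + a j *\<^sub>R N p) + (f p *\<^sub>R ?K (e i) + a i *\<^sub>R N p) \<bullet> ?L 0 (e j)" for i j
  have "((\<lambda>s. P s $ i $ j) has_real_derivative P' i j) (at 0)" for i j
  proof -
    have "((\<lambda>s. ?L s (e i) \<bullet> ?L s (e j)) has_real_derivative P' i j) (at 0)"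
      using has_derivative_inner[OF a[of i, unfolded has_vector_derivative_def] a[of j, unfolded has_vector_derivative_def]]
      unfolding has_field_derivative_def P'_def
      by (rule has_derivative_eq_rhs) (auto simp: fun_eq_iff algebra_simps inner_add_left inner_add_right)
    then show ?thesis
      by (rule has_field_derivative_transform_within_open[of _ _ _ ?I]) (use 0 P in auto)
  qed
  from has_real_derivative_det_at_identity[OF P0 this]
  have "((\<lambda>s. det (P s)) has_real_derivative (\<Sum>i\<in>UNIV. P' i i)) (at 0)" .
  moreover have "(\<Sum>i\<in>UNIV. P' i i) = - 2 * f p * mean_curvature A (X 0) N p"
  proof -
    have "orthonormal_frame c (X 0) p e" using e by (simp add: orthonormal_frame_def orthonormal_images_def)
    from mean_curvature_eq_trace[OF M X0(1) N'(1) c this]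
    have H: "mean_curvature A (X 0) N p = (\<Sum>i\<in>UNIV. - (?K (e i) \<bullet> ?L 0 (e i)))"
      by (simp add: second_fundamental_form_def)
    have "P' i i = - 2 * f p * (- (?K (e i) \<bullet> ?L 0 (e i)))" for i
      unfolding P'_def using N'(2) by (simp add: inner_add_left inner_add_right inner_commute)
    then show ?thesis unfolding H by (simp add: sum_distrib_left)
  qed
  ultimately show ?thesis unfolding detP by simp
qed

section \<open>Area measures\<close>

lemma area_measure_sets:
  assumes "area_measure M A X \<mu>"
  shows "space \<mu> = topspace M" "sets \<mu> = sigma_sets (topspace M) {U. openin M U}"
    and "\<And>U. openin M U \<Longrightarrow> U \<in> sets \<mu>"
  using assms by (auto simp: area_measure_def intro: sigma_sets.Basic)

lemma borel_measurable_restrict_continuous_map: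
  fixes k :: "'a \<Rightarrow> 'v::topological_space"
  assumes \<mu>: "area_measure M A X \<mu>" and U: "openin M U" and k: "continuous_map (subtopology M U) euclidean k"
  shows "k \<in> borel_measurable (restrict_space \<mu> U)"
proof (rule borel_measurableI)
  fix S :: "'v set" assume "open S"
  have sp: "space (restrict_space \<mu> U) = U" "topspace (subtopology M U) = U"
    using area_measure_sets(1)[OF \<mu>] openin_subset[OF U] by (auto simp: space_restrict_space)
  have "openin (subtopology M U) {p \<in> U. k p \<in> S}"
    using openin_continuous_map_preimage[OF k, of S] \<open>open S\<close> unfolding sp by simp
  then have "openin M {p \<in> U. k p \<in> S}" using U openin_trans_full by blast
  then have "{p \<in> U. k p \<in> S} \<in> sets \<mu>" by (rule area_measure_sets(3)[OF \<mu>])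
  then have "{p \<in> U. k p \<in> S} \<in> sets (restrict_space \<mu> U)"
    using area_measure_sets(3)[OF \<mu> U] by (subst sets_restrict_space_iff) (auto intro: sets.Int)
  moreover have "k -` S \<inter> space (restrict_space \<mu> U) = {p \<in> U. k p \<in> S}" using sp by auto
  ultimately show "k -` S \<inter> space (restrict_space \<mu> U) \<in> sets (restrict_space \<mu> U)" by simp
qed

lemma borel_measurable_continuous_map:
  fixes k :: "'a \<Rightarrow> 'v::topological_space"
  assumes \<mu>: "area_measure M A X \<mu>" and k: "continuous_map M euclidean k"
  shows "k \<in> borel_measurable \<mu>"
proof (rule borel_measurableI)
  fix S :: "'v set" assume "open S"
  then have "openin M {p \<in> topspace M. k p \<in> S}"
    using openin_continuous_map_preimage[OF k, of S] by simp
  moreover have "k -` S \<inter> space \<mu> = {p \<in> topspace M. k p \<in> S}" 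
    using area_measure_sets(1)[OF \<mu>] by auto
  ultimately show "k -` S \<inter> space \<mu> \<in> sets \<mu>" using area_measure_sets(3)[OF \<mu>] by simp
qed

text \<open>On the chart domain \<open>\<mu>\<close> is the image under the parametrization of Lebesgue measure with density
  \<open>sqrt (det g)\<close>: the definition of an area measure states this for sets, and integrals follow by
  transport of measure.\<close>

lemma area_measure_integral_in_chart:
  fixes A :: "('a, 'n::finite) chart set"
  assumes \<mu>: "area_measure M A X \<mu>" and c: "c \<in> A" "is_chart M c"
    and g: "continuous_on (snd c ` fst c) (\<lambda>x. det (metric_matrix c X (chart_inv c x)))"
    and J: "J \<in> borel_measurable \<mu>" and B: "B \<in> sets \<mu>" "B \<subseteq> fst c"
  shows "(\<integral>\<^sup>+p. J p * indicator B p \<partial>\<mu>) =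
    (\<integral>\<^sup>+x\<in>snd c ` B. J (chart_inv c x) * ennreal (sqrt (det (metric_matrix c X (chart_inv c x)))) \<partial>lborel)"
proof -
  let ?U = "fst c" let ?V = "snd c ` fst c"
  note cb = chart_basics[OF c(2)] note ms = area_measure_sets[OF \<mu>]
  define \<delta> where "\<delta> x = ennreal (sqrt (det (metric_matrix c X (chart_inv c x))))" for x
  define LV where "LV = restrict_space lborel ?V"
  define R where "R = restrict_space \<mu> ?U"
  have U: "?U \<in> sets \<mu>" using ms(3) cb(2) by blast
  have Vb: "?V \<in> sets borel" using cb(4) by (rule borel_open)
  have spR: "space R = ?U" unfolding R_def using ms(1) cb(1) by (auto simp: space_restrict_space)
  have setsR: "E \<in> sets R \<longleftrightarrow> E \<in> sets \<mu> \<and> E \<subseteq> ?U" for E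
    unfolding R_def using U by (subst sets_restrict_space_iff) auto
  have spLV: "space LV = ?V" unfolding LV_def by (simp add: space_restrict_space)
  have \<delta>: "\<delta> \<in> borel_measurable LV"
  proof -
    have "(\<lambda>x. sqrt (det (metric_matrix c X (chart_inv c x)))) \<in> borel_measurable (restrict_space borel ?V)"
      by (intro borel_measurable_continuous_on_restrict continuous_intros g)
    then have "(\<lambda>x. sqrt (det (metric_matrix c X (chart_inv c x)))) \<in> borel_measurable LV"
      unfolding LV_def by (simp cong: measurable_cong_sets)
    then show ?thesis unfolding \<delta>_def by measurable
  qed
  have pre0: "chart_inv c -` W \<inter> ?V = snd c ` (?U \<inter> W)" for W
  proof (intro equalityI subsetI)
    fix x assume x: "x \<in> chart_inv c -` W \<inter> ?V"
    then have "chart_inv c x \<in> ?U \<inter> W" "x = snd c (chart_inv c x)" using cb(6,7) by simp_all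
    then show "x \<in> snd c ` (?U \<inter> W)" by blast
  next
    fix x assume "x \<in> snd c ` (?U \<inter> W)"
    then obtain q where "q \<in> ?U" "q \<in> W" "x = snd c q" by blast
    then show "x \<in> chart_inv c -` W \<inter> ?V" using cb(5) by simp
  qed
  have \<psi>\<mu>: "chart_inv c \<in> measurable LV \<mu>"
  proof (rule measurable_sigma_sets[OF ms(2)])
    show "{U. openin M U} \<subseteq> Pow (topspace M)" using openin_subset by blast
    show "chart_inv c \<in> space LV \<rightarrow> topspace M" using cb(1,7) spLV by blast
    fix W assume "W \<in> {U. openin M U}"
    then have W: "openin M W" by simp
    have "chart_inv c -` W \<inter> space LV = snd c ` (?U \<inter> W)"
      unfolding spLV by (rule pre0)
    moreover have "open (snd c ` (?U \<inter> W))" by (rule chart_image_open[OF c(2) W])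
    ultimately show "chart_inv c -` W \<inter> space LV \<in> sets LV"
      unfolding LV_def using Vb by (auto simp: sets_restrict_space_iff)
  qed
  then have \<psi>: "chart_inv c \<in> measurable LV R"
    unfolding R_def by (intro measurable_restrict_space2) (use spLV cb(7) in auto)
  have pre: "chart_inv c -` E \<inter> ?V = snd c ` E" if "E \<subseteq> ?U" for E
    using pre0[of E] that by (simp add: Int_absorb1)
  have imb: "snd c ` E \<in> sets borel" if "E \<in> sets \<mu>" "E \<subseteq> ?U" for E
  proof -
    have "chart_inv c -` E \<inter> space LV \<in> sets LV" using \<psi>\<mu> that(1) by (rule measurable_sets)
    then have "snd c ` E \<in> sets LV" using spLV pre[OF that(2)] by simp
    then show ?thesis unfolding LV_def using Vb by (simp add: sets_restrict_space_iff)
  qed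
  have LVint: "(\<integral>\<^sup>+x. g x * indicator Y x \<partial>LV) = (\<integral>\<^sup>+x. g x * indicator Y x \<partial>lborel)"
    if "Y \<subseteq> ?V" for Y and g :: "real ^ 'n \<Rightarrow> ennreal"
    unfolding LV_def using Vb that
    by (subst nn_integral_restrict_space) (auto intro!: nn_integral_cong split: split_indicator)
  have eqm: "distr (density LV \<delta>) R (chart_inv c) = R"
  proof (rule measure_eqI)
    fix E assume "E \<in> sets (distr (density LV \<delta>) R (chart_inv c))"
    then have E: "E \<in> sets R" "E \<in> sets \<mu>" "E \<subseteq> ?U" using setsR by auto
    have "emeasure (distr (density LV \<delta>) R (chart_inv c)) E = emeasure (density LV \<delta>) (snd c ` E)"
      using \<psi> E pre[OF E(3)] spLV by (subst emeasure_distr) auto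
    also have "\<dots> = (\<integral>\<^sup>+x\<in>snd c ` E. \<delta> x \<partial>LV)"
      using \<delta> imb[OF E(2,3)] E(3) Vb by (subst emeasure_density) (auto simp: LV_def sets_restrict_space_iff)
    also have "\<dots> = (\<integral>\<^sup>+x\<in>snd c ` E. \<delta> x \<partial>lborel)"
      by (rule LVint) (use E(3) in blast)
    also have "\<dots> = emeasure \<mu> E" using \<mu> c(1) E by (auto simp: area_measure_def \<delta>_def)
    also have "\<dots> = emeasure R E" unfolding R_def using U E
      by (subst emeasure_restrict_space) auto
    finally show "emeasure (distr (density LV \<delta>) R (chart_inv c)) E = emeasure R E" .
  qed simp
  have JR: "(\<lambda>p. J p * indicator B p) \<in> borel_measurable R"
    unfolding R_def using J B(1)
    by (intro measurable_restrict_space1 borel_measurable_times_ennreal borel_measurable_indicator)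
  have "(\<integral>\<^sup>+p. J p * indicator B p \<partial>\<mu>) = (\<integral>\<^sup>+p. J p * indicator B p \<partial>R)"
    unfolding R_def using U B(2)
    by (subst nn_integral_restrict_space) (auto intro!: nn_integral_cong simp: indicator_def)
  also have "\<dots> = (\<integral>\<^sup>+p. J p * indicator B p \<partial>distr (density LV \<delta>) R (chart_inv c))" unfolding eqm ..
  also have "\<dots> = (\<integral>\<^sup>+x. J (chart_inv c x) * indicator B (chart_inv c x) \<partial>density LV \<delta>)"
    using \<psi> JR by (subst nn_integral_distr) auto
  also have "\<dots> = (\<integral>\<^sup>+x. \<delta> x * (J (chart_inv c x) * indicator B (chart_inv c x)) \<partial>LV)"
    using \<delta> measurable_compose[OF \<psi> JR] by (subst nn_integral_density) auto
  also have "\<dots> = (\<integral>\<^sup>+x\<in>snd c ` B. J (chart_inv c x) * \<delta> x \<partial>LV)"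
  proof (rule nn_integral_cong)
    fix x assume "x \<in> space LV"
    then have x: "x \<in> ?V" using spLV by simp
    have "indicator B (chart_inv c x) = (indicator (snd c ` B) x :: ennreal)"
      using pre[OF B(2)] x by (auto simp: indicator_def)
    then show "\<delta> x * (J (chart_inv c x) * indicator B (chart_inv c x))
        = J (chart_inv c x) * \<delta> x * indicator (snd c ` B) x" by (simp add: mult_ac)
  qed
  also have "\<dots> = (\<integral>\<^sup>+x\<in>snd c ` B. J (chart_inv c x) * \<delta> x \<partial>lborel)"
    by (rule LVint) (use B(2) in blast)
  finally show ?thesis unfolding \<delta>_def .
qed

text \<open>Every point has a neighbourhood \<open>W\<close> that a chart maps into a closed ball inside the image of the chart; second
  countability (the Lindelof property) leaves countably many. The compact sets \<open>C k\<close> carry the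
  uniform bounds, and countability is needed to add up measures.\<close>

lemma countable_chart_ball_cover:
  fixes A :: "('a, 'n::finite) chart set"
  assumes M: "smooth_manifold M A" and ne: "topspace M \<noteq> {}"
  obtains c :: "nat \<Rightarrow> ('a, 'n) chart" and C :: "nat \<Rightarrow> (real ^ 'n) set" and W :: "nat \<Rightarrow> 'a set"
  where "\<And>k. c k \<in> A" "\<And>k. compact (C k)" "\<And>k. C k \<subseteq> snd (c k) ` fst (c k)"
    "\<And>k. openin M (W k)" "\<And>k. W k \<subseteq> fst (c k)" "\<And>k. snd (c k) ` W k \<subseteq> C k" "(\<Union>k. W k) = topspace M"
proof -
  have A: "\<And>c. c \<in> A \<Longrightarrow> is_chart M c" "(\<Union>c\<in>A. fst c) = topspace M"
    using M unfolding smooth_manifold_def by blast+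
  define Q where "Q c C W \<longleftrightarrow> c \<in> A \<and> compact C \<and> C \<subseteq> snd c ` fst c \<and> openin M W \<and> W \<subseteq> fst c \<and> snd c ` W \<subseteq> C"
    for c :: "('a, 'n) chart" and C W
  have "\<exists>c C W. Q c C W \<and> p \<in> W"
    if p: "p \<in> topspace M" for p
  proof -
    obtain c where c: "c \<in> A" "p \<in> fst c" using p A(2) by blast
    note cb = chart_basics[OF A(1)[OF c(1)]]
    obtain r where r: "r > 0" "cball (snd c p) r \<subseteq> snd c ` fst c"
      using cb(4) c(2) open_contains_cball by (metis imageI)
    define W where "W = {q \<in> fst c. snd c q \<in> ball (snd c p) r}"
    have "openin (subtopology M (fst c)) W"
      using openin_continuous_map_preimage[OF cb(8), of "ball (snd c p) r"] cb(1) unfolding W_def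
      by (simp add: Int_absorb1)
    then have "openin M W" using cb(2) openin_trans_full by blast
    moreover have "snd c ` W \<subseteq> cball (snd c p) r" "p \<in> W" "W \<subseteq> fst c"
      unfolding W_def using r c by auto
    ultimately have "Q c (cball (snd c p) r) W \<and> p \<in> W" using c r compact_cball unfolding Q_def by simp
    then show ?thesis by blast
  qed
  then obtain c C W where cCW: "\<And>p. p \<in> topspace M \<Longrightarrow> Q (c p) (C p) (W p) \<and> p \<in> W p"
    by metis
  have op: "openin M (W p)" "p \<in> W p" if "p \<in> topspace M" for p using cCW[OF that] by (simp_all add: Q_def)
  have "Lindelof_space M" using M by (simp add: smooth_manifold_def second_countable_imp_Lindelof_space)
  moreover have "(\<Union>(W ` topspace M)) = topspace M"
  proof (intro equalityI UN_least subsetI)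
    show "q \<in> topspace M" if "p \<in> topspace M" "q \<in> W p" for p q
      using op(1)[OF that(1)] that(2) openin_subset by blast
    show "p \<in> \<Union>(W ` topspace M)" if "p \<in> topspace M" for p using op(2)[OF that] that by blast
  qed
  ultimately obtain \<V> where V: "countable \<V>" "\<V> \<subseteq> W ` topspace M" "\<Union>\<V> = topspace M"
    using Lindelof_spaceD[of M "W ` topspace M"] op(1) by (metis (no_types, lifting) imageE)
  then obtain T where T: "countable T" "T \<subseteq> topspace M" "\<V> = W ` T"
    using countable_subset_image by metis
  have "T \<noteq> {}" using T(3) V(3) ne by (metis Union_empty image_empty)
  then have rT: "range (from_nat_into T) = T" using T(1) by (rule range_from_nat_into)
  then have P: "from_nat_into T k \<in> topspace M" for k using T(2) by blast
  have cov: "(\<Union>k. W (from_nat_into T k)) = topspace M"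
  proof -
    have "(\<Union>k. W (from_nat_into T k)) = \<Union>(W ` range (from_nat_into T))" by blast
    then show ?thesis unfolding rT using V(3) T(3) by simp
  qed
  show thesis
    by (rule that[of "\<lambda>k. c (from_nat_into T k)" "\<lambda>k. C (from_nat_into T k)" "\<lambda>k. W (from_nat_into T k)"])
       (use cCW[OF P] cov in \<open>simp_all add: Q_def\<close>)
qed

lemma measure_eqI_countable_partition:
  assumes sets: "sets \<mu> = sets \<nu>" and B: "\<And>k::nat. B k \<in> sets \<mu>" "disjoint_family B" "(\<Union>k. B k) = space \<mu>"
    and eq: "\<And>k E. E \<in> sets \<mu> \<Longrightarrow> E \<subseteq> B k \<Longrightarrow> emeasure \<mu> E = emeasure \<nu> E"
  shows "\<mu> = \<nu>"
proof (rule measure_eqI[OF sets])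
  fix E assume E: "E \<in> sets \<mu>"
  have U: "(\<Union>k. E \<inter> B k) = E" using B(3) sets.sets_into_space[OF E] by blast
  have m: "range (\<lambda>k. E \<inter> B k) \<subseteq> sets \<mu>" using E B(1) by blast
  have d: "disjoint_family (\<lambda>k. E \<inter> B k)" using B(2) by (auto simp: disjoint_family_on_def)
  have "emeasure \<mu> E = (\<Sum>k. emeasure \<mu> (E \<inter> B k))"
    using suminf_emeasure[OF m d] unfolding U by simp
  also have "\<dots> = (\<Sum>k. emeasure \<nu> (E \<inter> B k))" using E B(1) by (intro suminf_cong eq) auto
  also have "\<dots> = emeasure \<nu> E"
    using suminf_emeasure[OF m[unfolded sets] d] unfolding U by simp
  finally show "emeasure \<mu> E = emeasure \<nu> E" .
qed

text \<open>On the compact set \<open>C\<close> the determinant at \<open>s = 0\<close> has a positive minimum \<open>m\<close>, so dividing by it preserves the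
  Lipschitz bound.\<close>

lemma relative_area_bounds_on_chart_piece:
  fixes X :: "real \<Rightarrow> 'a \<Rightarrow> 'v::euclidean_space" and A :: "('a, 'n::finite) chart set"
  assumes c: "c \<in> A" "is_chart M c" and imm: "immersion A (X 0)" 
    and \<epsilon>: "\<epsilon> > 0" and X: "smooth_family A {-\<epsilon><..<\<epsilon>} X"
    and C: "compact C" "C \<subseteq> snd c ` fst c" and W: "W \<subseteq> fst c" "snd c ` W \<subseteq> C"
  obtains B where "\<forall>\<^sub>F s in nhds 0. \<forall>p\<in>W. norm (X s p - X 0 p) \<le> B * \<bar>s\<bar> \<and>
      \<bar>det (metric_matrix c (X s) p) / det (metric_matrix c (X 0) p) - 1\<bar> \<le> B * \<bar>s\<bar>"
proof -
  let ?g = "\<lambda>s x. det (metric_matrix c (X s) (chart_inv c x))"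
  note cb = chart_basics[OF c(2)]
  note ml = smooth_family_in_chart[OF X c \<epsilon> C]
  have pos: "?g 0 x > 0" if "x \<in> C" for x
    by (rule immersion_metric_det_pos[OF imm c(1)]) (use that C(2) cb(7) in blast)
  have cont: "continuous_on C (?g 0)" using continuous_on_subset[OF ml(4) C(2)] \<epsilon> by simp
  obtain m where m: "m > 0" "\<And>x. x \<in> C \<Longrightarrow> m \<le> ?g 0 x"
  proof (cases "C = {}")
    case False
    then obtain x0 where "x0 \<in> C" "\<forall>x\<in>C. ?g 0 x0 \<le> ?g 0 x"
      using continuous_attains_inf[OF C(1) _ cont] by blast
    then show thesis using that pos by blast
  qed (use that[of 1] in simp)
  obtain B1 B2 where B: "\<forall>\<^sub>F s in nhds 0. \<forall>x\<in>C. norm (X s (chart_inv c x) - X 0 (chart_inv c x)) \<le> B1 * \<bar>s\<bar>"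
     "\<forall>\<^sub>F s in nhds 0. \<forall>x\<in>C. norm (?g s x - ?g 0 x) \<le> B2 * \<bar>s\<bar>"
    using ml(1,2) unfolding lipschitz_at_0_def by blast
  from B have "\<forall>\<^sub>F s in nhds 0. \<forall>p\<in>W. norm (X s p - X 0 p) \<le> max B1 (B2 / m) * \<bar>s\<bar> \<and>
      \<bar>det (metric_matrix c (X s) p) / det (metric_matrix c (X 0) p) - 1\<bar> \<le> max B1 (B2 / m) * \<bar>s\<bar>"
  proof eventually_elim
    case (elim s)
    show ?case
    proof
      fix p assume p: "p \<in> W"
      have x: "snd c p \<in> C" "chart_inv c (snd c p) = p" using p W cb(5) by auto
      have g0: "m \<le> ?g 0 (snd c p)" by (rule m(2)[OF x(1)])
      have "norm (X s p - X 0 p) \<le> B1 * \<bar>s\<bar>" using elim(1) x by fastforce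
      also have "\<dots> \<le> max B1 (B2 / m) * \<bar>s\<bar>" by (intro mult_right_mono) auto
      finally have 1: "norm (X s p - X 0 p) \<le> max B1 (B2 / m) * \<bar>s\<bar>" .
      have "\<bar>?g s (snd c p) / ?g 0 (snd c p) - 1\<bar> = \<bar>?g s (snd c p) - ?g 0 (snd c p)\<bar> / ?g 0 (snd c p)"
        using g0 m(1) by (simp add: field_simps abs_divide)
      also have "\<dots> \<le> (B2 * \<bar>s\<bar>) / m"
        using elim(2) x(1) g0 m(1) by (intro frac_le) auto
      also have "\<dots> = (B2 / m) * \<bar>s\<bar>" by simp
      also have "\<dots> \<le> max B1 (B2 / m) * \<bar>s\<bar>" by (intro mult_right_mono) auto
      finally show "norm (X s p - X 0 p) \<le> max B1 (B2 / m) * \<bar>s\<bar> \<and>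
        \<bar>det (metric_matrix c (X s) p) / det (metric_matrix c (X 0) p) - 1\<bar> \<le> max B1 (B2 / m) * \<bar>s\<bar>"
        using 1 x(2) by simp
    qed
  qed
  then show thesis by (rule that)
qed

text \<open>Each point \<open>p\<close> is
  assigned the first piece \<open>W k\<close> of a countable cover that contains it, and \<open>D s p\<close> is computed in the chart of that
  piece. The support \<open>K\<close> meets the pieces with \<open>k \<le> n\<close> only, so finitely many constants suffice on \<open>K\<close>, and off
  \<open>K\<close> the ratio is constantly \<open>1\<close>.\<close>

lemma relative_area_density:
  fixes X :: "real \<Rightarrow> 'a \<Rightarrow> 'v::euclidean_space" and A :: "('a, 'n::finite) chart set"
  assumes M: "smooth_manifold M A" and imm: "immersion A (X 0)" and N: "unit_normal A (X 0) N"
    and \<epsilon>: "\<epsilon> > 0" and X: "smooth_family A {-\<epsilon><..<\<epsilon>} X"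
    and var: "\<And>p. p \<in> topspace M \<Longrightarrow> ((\<lambda>s. X s p) has_vector_derivative f p *\<^sub>R N p) (at 0)"
    and supp: "\<exists>K. compactin M K \<and> (\<forall>s\<in>{-\<epsilon><..<\<epsilon>}. \<forall>p\<in>topspace M - K. X s p = X 0 p)"
    and area: "\<And>s. s \<in> {-\<epsilon><..<\<epsilon>} \<Longrightarrow> area_measure M A (X s) (\<mu> s)"
  obtains D B where
    "\<And>p. p \<in> topspace M \<Longrightarrow> D 0 p = 1"
    "\<And>p. p \<in> topspace M \<Longrightarrow> ((\<lambda>s. D s p) has_real_derivative - 2 * f p * mean_curvature A (X 0) N p) (at 0)"
    "\<forall>\<^sub>F s in nhds 0. D s \<in> borel_measurable (\<mu> 0) \<and> \<mu> s = density (\<mu> 0) (\<lambda>p. ennreal (sqrt (D s p))) \<and>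
       (\<forall>p\<in>topspace M. D s p > 0 \<and> \<bar>D s p - 1\<bar> \<le> B * \<bar>s\<bar> \<and> norm (X s p - X 0 p) \<le> B * \<bar>s\<bar>)"
proof (cases "topspace M = {}")
  case True
  have I: "\<forall>\<^sub>F s in nhds 0. s \<in> {-\<epsilon><..<\<epsilon>}" using \<epsilon> by (intro eventually_nhds_in_open) auto
  have "\<mu> s = density (\<mu> 0) (\<lambda>p. ennreal (sqrt 1))" if "s \<in> {-\<epsilon><..<\<epsilon>}" for s
  proof (rule measure_eqI)
    have 0: "0 \<in> {-\<epsilon><..<\<epsilon>}" using \<epsilon> by simp
    note a = area_measure_sets[OF area[OF that]] area_measure_sets[OF area[OF 0]]
    show "sets (\<mu> s) = sets (density (\<mu> 0) (\<lambda>p. ennreal (sqrt 1)))" using a(2,5) by simp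
    fix E assume "E \<in> sets (\<mu> s)"
    then have "E = {}" using sets.sets_into_space a(1) True by blast
    then show "emeasure (\<mu> s) E = emeasure (density (\<mu> 0) (\<lambda>p. ennreal (sqrt 1))) E" by simp
  qed
  then have "\<forall>\<^sub>F s in nhds 0. (\<lambda>p. 1::real) \<in> borel_measurable (\<mu> 0) \<and> \<mu> s = density (\<mu> 0) (\<lambda>p. ennreal (sqrt 1)) \<and>
       (\<forall>p\<in>topspace M. (1::real) > 0 \<and> \<bar>1 - 1 :: real\<bar> \<le> 0 * \<bar>s\<bar> \<and> norm (X s p - X 0 p) \<le> 0 * \<bar>s\<bar>)"
    using I True by (auto elim!: eventually_mono)
  then show thesis by (rule that[rotated 2]) (use True in auto)
next
  case False
  let ?I = "{-\<epsilon><..<\<epsilon>}"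
  have I: "\<forall>\<^sub>F s in nhds 0. s \<in> ?I" using \<epsilon> by (intro eventually_nhds_in_open) auto
  have zero: "0 \<in> ?I" using \<epsilon> by simp
  obtain c C W where cCW: "\<And>k. c k \<in> A" "\<And>k. compact (C k)" "\<And>k. C k \<subseteq> snd (c k) ` fst (c k)"
    "\<And>k. openin M (W k)" "\<And>k. W k \<subseteq> fst (c k)" "\<And>k. snd (c k) ` W k \<subseteq> C k" "(\<Union>k::nat. W k) = topspace M"
    using countable_chart_ball_cover[OF M False] by metis
  have ch: "is_chart M (c k)" for k using M cCW(1) by (auto simp: smooth_manifold_def)
  define g where "g k s p = det (metric_matrix (c k) (X s) p)" for k s p
  define \<kappa> where "\<kappa> p = (LEAST k. p \<in> W k)" for p
  have \<kappa>: "p \<in> W (\<kappa> p)" if "p \<in> topspace M" for p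
    using that cCW(7) unfolding \<kappa>_def by (metis (mono_tags, lifting) LeastI_ex UN_E)
  define D where "D s p = g (\<kappa> p) s p / g (\<kappa> p) 0 p" for s p
  have pos: "g k 0 p > 0" if "p \<in> fst (c k)" for k p
    unfolding g_def by (rule immersion_metric_det_pos[OF imm cCW(1) that])
  define Bd where "Bd k B \<longleftrightarrow> (\<forall>\<^sub>F s in nhds 0. \<forall>p\<in>W k. norm (X s p - X 0 p) \<le> B * \<bar>s\<bar> \<and>
      \<bar>g k s p / g k 0 p - 1\<bar> \<le> B * \<bar>s\<bar>)" for k B
  have "\<exists>B. Bd k B" for k
    unfolding g_def Bd_def
    by (rule relative_area_bounds_on_chart_piece[OF cCW(1) ch imm \<epsilon> X cCW(2,3,5,6)]) blast
  then obtain b where b: "\<And>k. Bd k (b k)" by metis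
  obtain K where K: "compactin M K" "\<And>s p. s \<in> ?I \<Longrightarrow> p \<in> topspace M - K \<Longrightarrow> X s p = X 0 p" using supp by blast
  obtain n where n: "K \<subseteq> (\<Union>k\<le>n. W k)"
  proof -
    have "K \<subseteq> \<Union>(range W)" "\<And>U. U \<in> range W \<Longrightarrow> openin M U" using K(1) cCW(4,7) by (auto simp: compactin_def)
    then obtain \<F> where "finite \<F>" "\<F> \<subseteq> range W" "K \<subseteq> \<Union>\<F>" using compactinD[OF K(1)] by metis
    then obtain T where T: "finite T" "\<F> = W ` T" by (meson finite_subset_image)
    then have "T \<subseteq> {..Max T}" by auto
    then show thesis using that[of "Max T"] T \<open>K \<subseteq> \<Union>\<F>\<close> by blast
  qed
  have opK: "openin M (topspace M - K)"
    using compactin_imp_closedin[OF _ K(1)] M by (auto simp: smooth_manifold_def)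
  have off: "g k s p = g k 0 p" if "s \<in> ?I" "p \<in> fst (c k)" "p \<in> topspace M - K" for k s p
  proof -
    have "chart_deriv (c k) (X 0) p = chart_deriv (c k) (X s) p"
    proof (rule chart_deriv_local[OF ch opK that(2,3)])
      show "X 0 q = X s q" if "q \<in> topspace M - K" for q using K(2) \<open>s \<in> ?I\<close> that by metis
      show "(X 0 \<circ> chart_inv (c k)) differentiable (at (snd (c k) p))"
        using imm cCW(1) that(2) by (auto simp: immersion_def intro: smooth_map_chart_differentiable(1))
    qed
    then show ?thesis by (simp add: g_def metric_matrix_def)
  qed
  define B where "B = (\<Sum>k\<le>n. \<bar>b k\<bar>)"
  have bB: "b k * \<bar>s\<bar> \<le> B * \<bar>s\<bar>" if "k \<le> n" for k and s :: real
  proof -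
    have "\<bar>b k\<bar> \<le> B" unfolding B_def using that by (intro member_le_sum) auto
    then show ?thesis by (intro mult_right_mono) auto
  qed
  have B0: "B \<ge> 0" unfolding B_def by (intro sum_nonneg) auto
  have "\<forall>\<^sub>F s in nhds 0. \<forall>k\<in>{..n}. \<forall>p\<in>W k. norm (X s p - X 0 p) \<le> b k * \<bar>s\<bar> \<and> \<bar>g k s p / g k 0 p - 1\<bar> \<le> b k * \<bar>s\<bar>"
    using b unfolding Bd_def by (intro eventually_ball_finite) auto
  with I have bounds: "\<forall>\<^sub>F s in nhds 0. \<forall>p\<in>topspace M. \<bar>D s p - 1\<bar> \<le> B * \<bar>s\<bar> \<and> norm (X s p - X 0 p) \<le> B * \<bar>s\<bar>"
  proof eventually_elim
    case (elim s)
    show ?case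
    proof
      fix p assume p: "p \<in> topspace M"
      show "\<bar>D s p - 1\<bar> \<le> B * \<bar>s\<bar> \<and> norm (X s p - X 0 p) \<le> B * \<bar>s\<bar>"
      proof (cases "p \<in> K")
        case True
        then obtain k where "k \<le> n" "p \<in> W k" using n by blast
        then have "\<kappa> p \<le> n" unfolding \<kappa>_def using Least_le order_trans by metis
        then show ?thesis using elim(2) \<kappa>[OF p] bB[of "\<kappa> p" s] unfolding D_def by fastforce
      next
        case False
        have pf: "p \<in> fst (c (\<kappa> p))" using \<kappa>[OF p] cCW(5) by blast
        have "D s p = 1" unfolding D_def using off[OF elim(1) pf] pos[OF pf] p False by simp
        moreover have "X s p = X 0 p" using K(2) elim(1) p False by blast
        ultimately show ?thesis using B0 by simp
      qed
    qed
  qed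
  \<comment> \<open>For \<open>\<bar>s\<bar> < 1 / (B + 1)\<close> the bound gives \<open>\<bar>D s p - 1\<bar> < 1\<close>. Positivity matters because \<open>X s\<close> need not
    be an immersion for \<open>s \<noteq> 0\<close>.\<close>
  have "\<forall>\<^sub>F s in nhds 0. s \<in> {-1/(B+1)<..<1/(B+1)}" using B0 by (intro eventually_nhds_in_open) auto
  with bounds have Dpos: "\<forall>\<^sub>F s in nhds 0. \<forall>p\<in>topspace M. D s p > 0"
  proof eventually_elim
    case (elim s)
    have "\<bar>s\<bar> * (B + 1) < 1" using elim(2) B0 by (auto simp: abs_if field_simps)
    then have "B * \<bar>s\<bar> < 1" using abs_ge_zero[of s] by (simp add: algebra_simps)
    then show ?case using elim(1) by (smt (verit))
  qed
  \<comment> \<open>The sets \<open>P k\<close> partition \<open>M\<close>, and on \<open>P k\<close> the function \<open>D s\<close> is computed in the single chart \<open>c k\<close>.\<close>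
  define P where "P k = {p \<in> topspace M. \<kappa> p = k}" for k
  note ms = area_measure_sets[OF area[OF zero]]
  have PW: "P k \<subseteq> W k" for k unfolding P_def using \<kappa> by auto
  have P_eq: "P k = W k - (\<Union>j<k. W j)" for k
  proof (intro equalityI subsetI)
    fix p assume p: "p \<in> P k"
    then show "p \<in> W k - (\<Union>j<k. W j)" using PW unfolding P_def \<kappa>_def by (auto dest: not_less_Least)
  next
    fix p assume p: "p \<in> W k - (\<Union>j<k. W j)"
    then have "\<kappa> p = k" unfolding \<kappa>_def by (intro Least_equality) (auto simp: not_le[symmetric])
    then show "p \<in> P k" unfolding P_def using p cCW(7) by auto
  qed
  have Wm: "W k \<in> sets (\<mu> 0)" for k using ms(3) cCW(4) by blast
  have Pm: "P k \<in> sets (\<mu> 0)" for k unfolding P_eq using Wm by (intro sets.Diff sets.countable_UN') auto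
  have PU: "(\<Union>k. P k) = topspace M" unfolding P_def by auto
  have Pd: "disjoint_family P" unfolding P_def by (auto simp: disjoint_family_on_def)
  have gc: "continuous_on (snd (c k) ` fst (c k)) (\<lambda>x. g k s (chart_inv (c k) x))" if "s \<in> ?I" for k s
    unfolding g_def by (rule smooth_family_in_chart(4)[OF X cCW(1) ch \<epsilon> cCW(2,3) that])
  have Dm: "D s \<in> borel_measurable (\<mu> 0)" if s: "s \<in> ?I" for s
  proof (rule measurable_piecewise_restrict[of "range P"])
    show "space (\<mu> 0) \<subseteq> \<Union>(range P)" using PU ms(1) by simp
    fix \<Omega> assume "\<Omega> \<in> range P"
    then obtain k where k: "\<Omega> = P k" by auto
    show "\<Omega> \<inter> space (\<mu> 0) \<in> sets (\<mu> 0)" using Pm k by auto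
    let ?U = "fst (c k)" let ?r = "\<lambda>p. g k s (chart_inv (c k) (snd (c k) p)) / g k 0 (chart_inv (c k) (snd (c k) p))"
    have "continuous_on (snd (c k) ` ?U) (\<lambda>x. g k s (chart_inv (c k) x) / g k 0 (chart_inv (c k) x))"
      using pos chart_basics(7)[OF ch] by (intro continuous_intros gc s zero ballI) (metis less_irrefl)
    from continuous_map_chart[OF ch this]
    have "?r \<in> borel_measurable (restrict_space (\<mu> 0) ?U)"
      by (rule borel_measurable_restrict_continuous_map[OF area[OF zero] chart_basics(2)[OF ch]])
    then have "?r \<in> borel_measurable (restrict_space (\<mu> 0) (P k))"
      by (rule measurable_restrict_mono) (use PW cCW(5) in blast)
    moreover have "?r p = D s p" if "p \<in> space (restrict_space (\<mu> 0) (P k))" for p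
    proof -
      have "p \<in> P k" using that by (simp add: space_restrict_space)
      moreover have "p \<in> ?U" using \<open>p \<in> P k\<close> PW cCW(5) by blast
      ultimately show ?thesis using chart_basics(5)[OF ch] by (simp add: P_def D_def)
    qed
    ultimately show "D s \<in> borel_measurable (restrict_space (\<mu> 0) \<Omega>)"
      unfolding k by (simp cong: measurable_cong)
  qed simp
  have dens: "\<mu> s = density (\<mu> 0) (\<lambda>p. ennreal (sqrt (D s p)))" if s: "s \<in> ?I" and Ds: "\<forall>p\<in>topspace M. D s p > 0" for s
  proof (rule measure_eqI_countable_partition[of _ _ P])
    note ms' = area_measure_sets[OF area[OF s]]
    have ss: "sets (\<mu> s) = sets (\<mu> 0)" using ms(2) ms'(2) by simp
    then show "sets (\<mu> s) = sets (density (\<mu> 0) (\<lambda>p. ennreal (sqrt (D s p))))" by simp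
    show "P k \<in> sets (\<mu> s)" for k using Pm ss by simp
    show "(\<Union>k. P k) = space (\<mu> s)" using PU ms'(1) by simp
    fix k E assume E: "E \<in> sets (\<mu> s)" "E \<subseteq> P k"
    then have E': "E \<in> sets (\<mu> 0)" "E \<subseteq> fst (c k)" using ss PW cCW(5) by blast+
    have Jm: "(\<lambda>p. ennreal (sqrt (D s p))) \<in> borel_measurable (\<mu> 0)" using Dm[OF s] by measurable
    have "emeasure (density (\<mu> 0) (\<lambda>p. ennreal (sqrt (D s p)))) E = (\<integral>\<^sup>+p. ennreal (sqrt (D s p)) * indicator E p \<partial>\<mu> 0)"
      by (rule emeasure_density[OF Jm E'(1)])
    also have "\<dots> = (\<integral>\<^sup>+x\<in>snd (c k) ` E. ennreal (sqrt (D s (chart_inv (c k) x))) * ennreal (sqrt (g k 0 (chart_inv (c k) x))) \<partial>lborel)"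
      using area_measure_integral_in_chart[OF area[OF zero] cCW(1) ch gc[OF zero, unfolded g_def] Jm E'] by (simp add: g_def)
    also have "\<dots> = (\<integral>\<^sup>+x\<in>snd (c k) ` E. ennreal (sqrt (g k s (chart_inv (c k) x))) \<partial>lborel)"
    proof (intro nn_integral_cong)
      fix x
      show "ennreal (sqrt (D s (chart_inv (c k) x))) * ennreal (sqrt (g k 0 (chart_inv (c k) x))) * indicator (snd (c k) ` E) x
          = ennreal (sqrt (g k s (chart_inv (c k) x))) * indicator (snd (c k) ` E) x"
      proof (cases "x \<in> snd (c k) ` E")
        case True
        then obtain p where p: "p \<in> E" "x = snd (c k) p" by blast
        have "chart_inv (c k) x = p" using chart_basics(5)[OF ch] p E'(2) by blast
        moreover have "D s p = g k s p / g k 0 p" using p(1) E(2) by (auto simp: P_def D_def)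
        moreover have "g k 0 p > 0" using pos p(1) E'(2) by blast
        moreover have "D s p > 0" using Ds E(2) p(1) by (auto simp: P_def)
        ultimately show ?thesis by (simp add: ennreal_mult'[symmetric] real_sqrt_mult[symmetric])
      qed simp
    qed
    also have "\<dots> = emeasure (\<mu> s) E"
      using area[OF s] cCW(1)[of k] E E'(2) unfolding area_measure_def g_def by simp
    finally show "emeasure (\<mu> s) E = emeasure (density (\<mu> 0) (\<lambda>p. ennreal (sqrt (D s p)))) E" by simp
  qed (rule Pd)
  show thesis
  proof (rule that[of D B])
    fix p assume p: "p \<in> topspace M"
    have pf: "p \<in> fst (c (\<kappa> p))" using \<kappa>[OF p] cCW(5) by blast
    show "D 0 p = 1" unfolding D_def using pos[OF pf] by simp
    show "((\<lambda>s. D s p) has_real_derivative - 2 * f p * mean_curvature A (X 0) N p) (at 0)"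
      unfolding D_def g_def by (rule derivative_of_metric_det[OF M imm N \<epsilon> X var cCW(1) pf])
  next
    show "\<forall>\<^sub>F s in nhds 0. D s \<in> borel_measurable (\<mu> 0) \<and> \<mu> s = density (\<mu> 0) (\<lambda>p. ennreal (sqrt (D s p))) \<and>
       (\<forall>p\<in>topspace M. D s p > 0 \<and> \<bar>D s p - 1\<bar> \<le> B * \<bar>s\<bar> \<and> norm (X s p - X 0 p) \<le> B * \<bar>s\<bar>)"
      using I bounds Dpos by eventually_elim (auto intro: Dm dens)
  qed
qed

section \<open>Gaussian weights\<close>

text \<open>Write \<open>\<beta> = 1/(2t) - 1/(2\<tau>) > 0\<close> and use \<open>1 + \<beta> r\<^sup>2 \<le> exp (\<beta> r\<^sup>2)\<close>.\<close>

lemma polynomial_times_gaussian_le: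
  fixes t \<tau> :: real
  assumes "0 < t" "t < \<tau>"
  obtains C where "C > 0" "\<And>r. (1 + r\<^sup>2) * exp (- r\<^sup>2 / (2 * t)) \<le> C * exp (- r\<^sup>2 / (2 * \<tau>))"
proof -
  define \<beta> where "\<beta> = 1 / (2 * t) - 1 / (2 * \<tau>)"
  have \<beta>: "\<beta> > 0" unfolding \<beta>_def using assms by (simp add: field_simps)
  show thesis
  proof (rule that[of "1 + 1 / \<beta>"])
    show "1 + 1 / \<beta> > 0" using \<beta> by (simp add: add_pos_pos)
    fix r :: real
    have "1 + \<beta> * r\<^sup>2 \<le> exp (\<beta> * r\<^sup>2)" by (rule exp_ge_add_one_self)
    then have "1 + r\<^sup>2 \<le> (1 + 1 / \<beta>) * exp (\<beta> * r\<^sup>2)"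
    proof -
      assume *: "1 + \<beta> * r\<^sup>2 \<le> exp (\<beta> * r\<^sup>2)"
      have "1 + r\<^sup>2 \<le> (1 + 1 / \<beta>) * (1 + \<beta> * r\<^sup>2)" using \<beta> by (simp add: field_simps)
      also have "\<dots> \<le> (1 + 1 / \<beta>) * exp (\<beta> * r\<^sup>2)" using * \<beta> by (intro mult_left_mono) auto
      finally show ?thesis .
    qed
    then have "(1 + r\<^sup>2) * exp (- r\<^sup>2 / (2 * t)) \<le> (1 + 1 / \<beta>) * exp (\<beta> * r\<^sup>2) * exp (- r\<^sup>2 / (2 * t))"
      by (intro mult_right_mono) auto
    also have "\<dots> = (1 + 1 / \<beta>) * exp (\<beta> * r\<^sup>2 - r\<^sup>2 / (2 * t))"
      by (simp add: mult_exp_exp mult.assoc)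
    also have "\<beta> * r\<^sup>2 - r\<^sup>2 / (2 * t) = - r\<^sup>2 / (2 * \<tau>)" unfolding \<beta>_def by (simp add: algebra_simps)
    finally show "(1 + r\<^sup>2) * exp (- r\<^sup>2 / (2 * t)) \<le> (1 + 1 / \<beta>) * exp (- r\<^sup>2 / (2 * \<tau>))" .
  qed
qed

lemma exp_minus_lipschitz:
  fixes a b m :: real
  assumes "m \<le> a" "m \<le> b"
  shows "\<bar>exp (- a) - exp (- b)\<bar> \<le> \<bar>a - b\<bar> * exp (- m)"
proof -
  have *: "exp (- a) - exp (- b) \<le> (b - a) * exp (- m)" if "a \<le> b" "m \<le> a" for a b :: real
  proof -
    have "1 - exp (a - b) \<le> b - a" using exp_ge_add_one_self[of "a - b"] by linarith
    then have "(1 - exp (a - b)) * exp (- a) \<le> (b - a) * exp (- a)" by (intro mult_right_mono) auto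
    moreover have "(1 - exp (a - b)) * exp (- a) = exp (- a) - exp (- b)"
      by (simp add: left_diff_distrib mult_exp_exp)
    moreover have "(b - a) * exp (- a) \<le> (b - a) * exp (- m)" using that by (intro mult_left_mono) auto
    ultimately show ?thesis by linarith
  qed
  show ?thesis
  proof (cases "a \<le> b")
    case True
    then have "exp (- b) \<le> exp (- a)" by simp
    then show ?thesis using *[OF True assms(1)] True by simp
  next
    case False
    then have "b \<le> a" "exp (- a) \<le> exp (- b)" by simp_all
    then show ?thesis using *[OF \<open>b \<le> a\<close> assms(2)] by simp
  qed
qed

text \<open>The exponents differ by at most a constant times \<open>\<sigma> (1 + r\<^sup>2)\<close>, and both are at least \<open>m = (r\<^sup>2 - \<kappa>) / (2 \<tau>2)\<close> for
  some \<open>\<tau>2\<close> strictly between \<open>t0\<close> and \<open>\<tau>\<close>. The remaining gap from \<open>\<tau>2\<close> to \<open>\<tau>\<close> absorbs the factor \<open>1 + r\<^sup>2\<close>.\<close>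

lemma gaussian_lipschitz:
  fixes t0 \<tau> L :: real
  assumes t0: "0 < t0" "t0 < \<tau>" and L: "L > 0"
  obtains C \<delta> where "C > 0" "\<delta> > 0"
    "\<And>\<sigma> \<rho> r t. \<sigma> \<le> \<delta> \<Longrightarrow> \<rho> \<ge> 0 \<Longrightarrow> r \<ge> 0 \<Longrightarrow> \<bar>\<rho> - r\<bar> \<le> L * \<sigma> \<Longrightarrow> \<bar>t - t0\<bar> \<le> L * \<sigma> \<Longrightarrow>
      \<bar>exp (- \<rho>\<^sup>2 / (2 * t)) - exp (- r\<^sup>2 / (2 * t0))\<bar> \<le> C * \<sigma> * exp (- r\<^sup>2 / (2 * \<tau>))"
proof -
  define \<tau>2 where "\<tau>2 = (t0 + \<tau>) / 2"
  define \<tau>1 where "\<tau>1 = (t0 + \<tau>2) / 2"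
  have \<tau>: "t0 < \<tau>1" "\<tau>1 < \<tau>2" "\<tau>2 < \<tau>" "0 < \<tau>1" "0 < \<tau>2" unfolding \<tau>1_def \<tau>2_def using t0 by (auto simp: field_simps)
  \<comment> \<open>\<open>\<tau>1\<close> bounds the perturbed scale \<open>t\<close>, and \<open>1 + \<eta>\<close> is the loss from replacing \<open>\<rho>\<close> by \<open>r\<close>.\<close>
  define \<eta> where "\<eta> = \<tau>2 / \<tau>1 - 1"
  have \<eta>: "\<eta> > 0" "\<tau>1 * (1 + \<eta>) = \<tau>2" unfolding \<eta>_def using \<tau> by (auto simp: field_simps)
  obtain C0 where C0: "C0 > 0" "\<And>r. (1 + r\<^sup>2) * exp (- r\<^sup>2 / (2 * \<tau>2)) \<le> C0 * exp (- r\<^sup>2 / (2 * \<tau>))"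
    using polynomial_times_gaussian_le[OF \<tau>(5,3)] by blast
  define \<kappa> where "\<kappa> = 1 + 1 / \<eta>"
  have \<kappa>: "\<kappa> > 0" unfolding \<kappa>_def using \<eta>(1) by (simp add: add_pos_pos)
  define q where "q = 2 / t0 + 1 / t0\<^sup>2"
  have q: "q > 0" unfolding q_def using t0 by (simp add: add_pos_pos)
  define \<delta> where "\<delta> = min 1 (min (\<tau>1 - t0) (t0 / 2)) / L"
  define C where "C = L * q * exp (\<kappa> / (2 * \<tau>2)) * C0"
  show thesis
  proof (rule that[of C \<delta>])
    show "C > 0" unfolding C_def using L q C0 by simp
    show "\<delta> > 0" unfolding \<delta>_def using L \<tau> t0 by simp
    fix \<sigma> \<rho> r t :: real
    assume \<sigma>: "\<sigma> \<le> \<delta>" and \<rho>: "\<rho> \<ge> 0" and r: "r \<ge> 0" and d: "\<bar>\<rho> - r\<bar> \<le> L * \<sigma>" and t: "\<bar>t - t0\<bar> \<le> L * \<sigma>"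
    have L\<sigma>: "L * \<sigma> \<le> min 1 (min (\<tau>1 - t0) (t0 / 2))" 
      using \<sigma> L unfolding \<delta>_def by (simp add: field_simps)
    have L\<sigma>0: "L * \<sigma> \<ge> 0" using d by linarith
    then have \<sigma>0: "\<sigma> \<ge> 0" using L by (simp add: zero_le_mult_iff)
    have t': "t \<le> \<tau>1" "t0 / 2 \<le> t" "t > 0" using t L\<sigma> t0 by (auto simp: abs_le_iff)
    define a where "a = \<rho>\<^sup>2 / (2 * t)"
    define b where "b = r\<^sup>2 / (2 * t0)"
    define m where "m = (r\<^sup>2 - \<kappa>) / (2 * \<tau>2)"
    have "r \<le> \<rho> + 1" using d L\<sigma> by auto
    then have "r\<^sup>2 \<le> (\<rho> + 1)\<^sup>2" using r by (intro power_mono) auto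
    also have "(\<rho> + 1)\<^sup>2 = (1 + \<eta>) * \<rho>\<^sup>2 + \<kappa> - (\<eta> * \<rho> - 1)\<^sup>2 / \<eta>"
      unfolding \<kappa>_def using \<eta>(1) by (simp add: field_simps power2_eq_square)
    also have "\<dots> \<le> (1 + \<eta>) * \<rho>\<^sup>2 + \<kappa>" using \<eta>(1) by simp
    finally have r2: "r\<^sup>2 - \<kappa> \<le> (1 + \<eta>) * \<rho>\<^sup>2" by simp
    have "m \<le> ((1 + \<eta>) * \<rho>\<^sup>2) / (2 * \<tau>2)" unfolding m_def using r2 \<tau> by (intro divide_right_mono) auto
    also have "\<dots> = \<rho>\<^sup>2 / (2 * \<tau>1)" using \<eta> \<tau> by (simp add: \<eta>(2)[symmetric] field_simps)
    also have "\<dots> \<le> a" unfolding a_def using t' by (intro divide_left_mono) auto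
    finally have ma: "m \<le> a" .
    have "m \<le> r\<^sup>2 / (2 * \<tau>2)" unfolding m_def using \<kappa> \<tau> by (intro divide_right_mono) auto
    also have "\<dots> \<le> b" unfolding b_def using \<tau> t0 by (intro divide_left_mono) auto
    finally have mb: "m \<le> b" .
    have ab: "\<bar>a - b\<bar> \<le> L * \<sigma> * q * (1 + r\<^sup>2)"
    proof -
      have inv: "1 / (2 * t) \<le> 1 / t0" using t'(2,3) t0 by (simp add: field_simps)
      have "\<bar>1 / (2 * t) - 1 / (2 * t0)\<bar> = \<bar>t - t0\<bar> * (1 / (2 * t)) * (1 / t0)"
        using t' t0 by (simp add: field_simps abs_if)
      also have "\<dots> \<le> (L * \<sigma>) * (1 / t0) * (1 / t0)"
        using t inv t' t0 L\<sigma>0 by (intro mult_mono) auto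
      finally have 1: "\<bar>1 / (2 * t) - 1 / (2 * t0)\<bar> \<le> L * \<sigma> / t0\<^sup>2" by (simp add: power2_eq_square)
      have "2 * r \<le> r\<^sup>2 + 1" using zero_le_power2[of "r - 1"] by (simp add: power2_diff)
      moreover have "\<rho> + r \<le> 2 * r + 1" using d L\<sigma> by auto
      ultimately have "\<rho> + r \<le> 2 * (1 + r\<^sup>2)" using zero_le_power2[of r] by argo
      then have "\<bar>\<rho> - r\<bar> * (\<rho> + r) * (1 / (2 * t)) \<le> (L * \<sigma>) * (2 * (1 + r\<^sup>2)) * (1 / t0)"
        using d inv t' \<rho> r L\<sigma>0 by (intro mult_mono) auto
      moreover have "\<bar>(\<rho>\<^sup>2 - r\<^sup>2) * (1 / (2 * t))\<bar> = \<bar>\<rho> - r\<bar> * (\<rho> + r) * (1 / (2 * t))"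
        using \<rho> r t'(3) by (simp add: power2_eq_square square_diff_square_factored abs_mult)
      moreover have "(L * \<sigma>) * (2 * (1 + r\<^sup>2)) * (1 / t0) = (L * \<sigma>) * (2 / t0) * (1 + r\<^sup>2)"
        by simp
      ultimately have 2: "\<bar>(\<rho>\<^sup>2 - r\<^sup>2) * (1 / (2 * t))\<bar> \<le> (L * \<sigma>) * (2 / t0) * (1 + r\<^sup>2)"
        by argo
      have 3: "\<bar>r\<^sup>2 * (1 / (2 * t) - 1 / (2 * t0))\<bar> \<le> (1 + r\<^sup>2) * (L * \<sigma> / t0\<^sup>2)"
        unfolding abs_mult using 1 by (intro mult_mono) auto
      have "a - b = (\<rho>\<^sup>2 - r\<^sup>2) * (1 / (2 * t)) + r\<^sup>2 * (1 / (2 * t) - 1 / (2 * t0))"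
        unfolding a_def b_def by (simp add: algebra_simps)
      then have "\<bar>a - b\<bar> \<le> \<bar>(\<rho>\<^sup>2 - r\<^sup>2) * (1 / (2 * t))\<bar> + \<bar>r\<^sup>2 * (1 / (2 * t) - 1 / (2 * t0))\<bar>"
        by (simp only: abs_triangle_ineq)
      also have "\<dots> \<le> (L * \<sigma>) * (2 / t0) * (1 + r\<^sup>2) + (1 + r\<^sup>2) * (L * \<sigma> / t0\<^sup>2)"
        by (rule add_mono[OF 2 3])
      also have "\<dots> = L * \<sigma> * q * (1 + r\<^sup>2)" unfolding q_def by (simp add: algebra_simps)
      finally show ?thesis .
    qed
    have "\<bar>exp (- a) - exp (- b)\<bar> \<le> \<bar>a - b\<bar> * exp (- m)" by (rule exp_minus_lipschitz[OF ma mb])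
    also have "\<dots> \<le> L * \<sigma> * q * (1 + r\<^sup>2) * exp (- m)" using ab by (intro mult_right_mono) auto
    also have "exp (- m) = exp (\<kappa> / (2 * \<tau>2)) * exp (- r\<^sup>2 / (2 * \<tau>2))"
      unfolding m_def by (simp add: mult_exp_exp diff_divide_distrib)
    also have "L * \<sigma> * q * (1 + r\<^sup>2) * (exp (\<kappa> / (2 * \<tau>2)) * exp (- r\<^sup>2 / (2 * \<tau>2)))
        = L * \<sigma> * q * exp (\<kappa> / (2 * \<tau>2)) * ((1 + r\<^sup>2) * exp (- r\<^sup>2 / (2 * \<tau>2)))" by (simp add: mult_ac)
    also have "\<dots> \<le> L * \<sigma> * q * exp (\<kappa> / (2 * \<tau>2)) * (C0 * exp (- r\<^sup>2 / (2 * \<tau>)))"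
      using C0(2) L\<sigma>0 q by (intro mult_left_mono) auto
    also have "\<dots> = C * \<sigma> * exp (- r\<^sup>2 / (2 * \<tau>))" unfolding C_def by (simp add: mult_ac)
    finally show "\<bar>exp (- \<rho>\<^sup>2 / (2 * t)) - exp (- r\<^sup>2 / (2 * t0))\<bar> \<le> C * \<sigma> * exp (- r\<^sup>2 / (2 * \<tau>))"
      unfolding a_def b_def by simp
  qed
qed

lemma sqrt_minus_one_le:
  assumes "d > 0" shows "\<bar>sqrt d - 1\<bar> \<le> \<bar>d - 1\<bar>"
proof -
  have "\<bar>d - 1\<bar> = \<bar>sqrt d - 1\<bar> * (sqrt d + 1)"
    using assms real_sqrt_gt_zero[OF assms] abs_mult[of "sqrt d - 1" "sqrt d + 1"]
    by (simp add: algebra_simps)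
  moreover have "\<bar>sqrt d - 1\<bar> * 1 \<le> \<bar>sqrt d - 1\<bar> * (sqrt d + 1)" using assms by (intro mult_left_mono) auto
  ultimately show ?thesis by simp
qed

section \<open>First variation of the functional\<close>

text \<open>The functions \<open>\<Phi> s\<close> and \<open>\<Psi> s\<close> below are the two integrands after both integrals have been moved to \<open>\<mu> 0\<close>.
  Linearity of the integral needs each summand to be integrable. For the terms without \<open>f\<close> and \<open>H\<close> this is
  the comparison with the wider Gaussian \<open>G\<close>; the term with \<open>f\<close> and \<open>H\<close> is then a combination of these and of the
  pointwise derivatives \<open>\<Phi>'\<close> and \<open>\<Psi>'\<close>, whose integrability comes with differentiation under the integral.\<close>

theorem lemma5p1:
  fixes M :: "'a topology" and A :: "('a, 'n::finite) chart set"
    and X :: "real \<Rightarrow> 'a \<Rightarrow> real ^ 'm::finite" and N :: "'a \<Rightarrow> real ^ 'm"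
    and \<mu> :: "real \<Rightarrow> 'a measure" and f :: "'a \<Rightarrow> real"
    and x :: "real \<Rightarrow> real ^ 'm" and t :: "real \<Rightarrow> real"
    and y :: "real ^ 'm" and h lam \<epsilon> :: real
  defines "n \<equiv> CARD('n)"
    and "H \<equiv> mean_curvature A (X 0) N"
    and "w \<equiv> (\<lambda>p. exp (- (norm (X 0 p - x 0))\<^sup>2 / (2 * t 0)))"
  assumes dim: "CARD('m) = n + 1"
    and manifold: "smooth_manifold M A"
    and hypersurface: "immersion A (X 0)"
    and normal: "unit_normal A (X 0) N"
    and eps: "\<epsilon> > 0"
    and smooth_X: "smooth_family A {-\<epsilon><..<\<epsilon>} X"
    and compact_support:
      "\<exists>K. compactin M K \<and> (\<forall>s\<in>{-\<epsilon><..<\<epsilon>}. \<forall>p\<in>topspace M - K. X s p = X 0 p)"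
    and normal_variation:
      "\<And>p. p \<in> topspace M \<Longrightarrow> ((\<lambda>s. X s p) has_vector_derivative f p *\<^sub>R N p) (at 0)"
    and area: "\<And>s. s \<in> {-\<epsilon><..<\<epsilon>} \<Longrightarrow> area_measure M A (X s) (\<mu> s)"
    and smooth_x: "smooth_on {-\<epsilon><..<\<epsilon>} x"
    and smooth_t: "smooth_on {-\<epsilon><..<\<epsilon>} t"
    and t_pos: "\<And>s. s \<in> {-\<epsilon><..<\<epsilon>} \<Longrightarrow> t s > 0"
    and deriv_x: "(x has_vector_derivative y) (at 0)"
    and deriv_t: "(t has_real_derivative h) (at 0)"
    and finite_integrals:
      "\<forall>\<^sub>F (z, \<tau>) in nhds (x 0, t 0). integrable (\<mu> 0) (\<lambda>p. exp (- (norm (X 0 p - z))\<^sup>2 / (2 * \<tau>)))"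
  shows "(F_functional n lam \<mu> X N x t has_real_derivative
      (4 * pi * t 0) powr (- real n / 2) *
        (\<integral>p. (lam - (H p + ((X 0 p - x 0) /\<^sub>R t 0) \<bullet> N p)) * f p * w p \<partial>\<mu> 0)
    + (4 * pi * t 0) powr (- real n / 2) *
        (\<integral>p. (((X 0 p - x 0) /\<^sub>R t 0) \<bullet> y - lam * (N p \<bullet> y)) * w p \<partial>\<mu> 0)
    + (4 * pi * t 0) powr (- real n / 2) *
        (\<integral>p. ((norm (X 0 p - x 0))\<^sup>2 / t 0 - real n - lam * ((X 0 p - x 0) \<bullet> N p))
              * (h / (2 * t 0)) * w p \<partial>\<mu> 0)) (at 0)"
proof -
  let ?I = "{-\<epsilon><..<\<epsilon>}"
  have zero: "0 \<in> ?I" using eps by simp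
  have I: "\<forall>\<^sub>F s in nhds 0. s \<in> ?I" using eps by (intro eventually_nhds_in_open) auto
  have t0: "t 0 > 0" by (rule t_pos[OF zero])
  note ms = area_measure_sets[OF area[OF zero]]
  have charts: "\<And>c. c \<in> A \<Longrightarrow> is_chart M c" "(\<Union>c\<in>A. fst c) = topspace M"
    using manifold unfolding smooth_manifold_def by blast+
  have N: "smooth_map A N" using normal by (simp add: unit_normal_def)
  have N1: "norm (N p) = 1" if "p \<in> topspace M" for p
    using that normal charts(2) unfolding unit_normal_def by blast
  have "continuous_map M euclidean (X s)" if "s \<in> ?I" for s
  proof (rule continuous_map_from_charts[OF charts])
    fix c assume c: "c \<in> A"
    show "continuous_on (snd c ` fst c) (X s \<circ> chart_inv c)"
      by (rule smooth_family_in_chart(3)[OF smooth_X c charts(1)[OF c] eps compact_empty empty_subsetI that])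
  qed
  then have Xm: "X s \<in> borel_measurable (\<mu> 0)" if "s \<in> ?I" for s
    using that borel_measurable_continuous_map[OF area[OF zero]] by blast
  have "continuous_map M euclidean N"
  proof (rule continuous_map_from_charts[OF charts])
    fix c assume "c \<in> A"
    then show "continuous_on (snd c ` fst c) (N \<circ> chart_inv c)"
      using N smooth_on_continuous unfolding smooth_map_def by blast
  qed
  then have Nm: "N \<in> borel_measurable (\<mu> 0)" by (rule borel_measurable_continuous_map[OF area[OF zero]])
  define u where "u p = X 0 p - x 0" for p
  have um: "u \<in> borel_measurable (\<mu> 0)" unfolding u_def using Xm[OF zero] by measurable
  have wm: "w \<in> borel_measurable (\<mu> 0)" unfolding w_def using Xm[OF zero] by measurable
  have w_u: "w p = exp (- (norm (u p))\<^sup>2 / (2 * t 0))" for p by (simp add: w_def u_def)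
  have w0: "w p > 0" for p by (simp add: w_def)
  \<comment> \<open>Finiteness for the centre \<open>x 0\<close> and a scale \<open>\<tau>\<close> slightly above \<open>t 0\<close> provides the majorant \<open>G\<close>.\<close>
  have "\<forall>\<^sub>F \<tau> in nhds (t 0). integrable (\<mu> 0) (\<lambda>p. exp (- (norm (u p))\<^sup>2 / (2 * \<tau>)))"
  proof -
    have "((\<lambda>\<tau>. (x 0, \<tau>)) \<longlongrightarrow> (x 0, t 0)) (nhds (t 0))"
      by (intro tendsto_intros filterlim_ident)
    from eventually_compose_filterlim[OF finite_integrals this] show ?thesis by (simp add: u_def)
  qed
  then obtain d where d: "d > 0" "\<And>\<tau>. dist \<tau> (t 0) < d \<Longrightarrow> integrable (\<mu> 0) (\<lambda>p. exp (- (norm (u p))\<^sup>2 / (2 * \<tau>)))"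
    unfolding eventually_nhds_metric by blast
  define \<tau> where "\<tau> = t 0 + d / 2"
  have \<tau>: "t 0 < \<tau>" using d(1) by (simp add: \<tau>_def)
  define G where "G p = exp (- (norm (u p))\<^sup>2 / (2 * \<tau>))" for p
  have Gint: "integrable (\<mu> 0) G" unfolding G_def by (rule d(2)) (use d(1) in \<open>simp add: \<tau>_def dist_real_def\<close>)
  obtain C1 where C1: "C1 > 0" "\<And>r. (1 + r\<^sup>2) * exp (- r\<^sup>2 / (2 * t 0)) \<le> C1 * exp (- r\<^sup>2 / (2 * \<tau>))"
    using polynomial_times_gaussian_le[OF t0 \<tau>] by blast
  have polyw: "(1 + (norm (u p))\<^sup>2) * w p \<le> C1 * G p" for p unfolding w_u G_def by (rule C1(2))
  have int_w: "integrable (\<mu> 0) (\<lambda>p. k p * w p)"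
    if k: "k \<in> borel_measurable (\<mu> 0)" "\<And>p. p \<in> topspace M \<Longrightarrow> \<bar>k p\<bar> \<le> c * (1 + (norm (u p))\<^sup>2)" for k c
  proof (rule Bochner_Integration.integrable_bound)
    show "integrable (\<mu> 0) (\<lambda>p. \<bar>c\<bar> * C1 * G p)" using Gint by simp
    show "(\<lambda>p. k p * w p) \<in> borel_measurable (\<mu> 0)" using k wm by measurable
    show "AE p in \<mu> 0. norm (k p * w p) \<le> norm (\<bar>c\<bar> * C1 * G p)"
    proof (rule AE_I2)
      fix p assume "p \<in> space (\<mu> 0)"
      then have "\<bar>k p\<bar> \<le> c * (1 + (norm (u p))\<^sup>2)" using k(2) ms(1) by simp
      also have "\<dots> \<le> \<bar>c\<bar> * (1 + (norm (u p))\<^sup>2)" by (intro mult_right_mono) auto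
      finally have "\<bar>k p\<bar> * w p \<le> \<bar>c\<bar> * (1 + (norm (u p))\<^sup>2) * w p" using w0[of p] by (intro mult_right_mono) auto
      also have "\<dots> \<le> \<bar>c\<bar> * (C1 * G p)" using mult_left_mono[OF polyw abs_ge_zero, of c p] by (simp add: mult.assoc)
      finally show "norm (k p * w p) \<le> norm (\<bar>c\<bar> * C1 * G p)" using w0[of p] C1 by (simp add: abs_mult G_def)
    qed
  qed
  have ru: "norm (u p) \<le> 1 + (norm (u p))\<^sup>2" for p
  proof -
    have "2 * norm (u p) \<le> (norm (u p))\<^sup>2 + 1"
      using zero_le_power2[of "norm (u p) - 1"] by (simp add: power2_diff)
    then show ?thesis using norm_ge_zero[of "u p"] by argo
  qed
  have int1: "integrable (\<mu> 0) w" using int_w[of "\<lambda>_. 1" 1] by simp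
  have int_r2: "integrable (\<mu> 0) (\<lambda>p. (norm (u p))\<^sup>2 * w p)" by (rule int_w[of _ 1]) (use um in auto)
  have int_uN: "integrable (\<mu> 0) (\<lambda>p. (u p \<bullet> N p) * w p)"
    by (rule int_w[of _ 1]) (use um Nm ru N1 Cauchy_Schwarz_ineq2[of "u _" "N _"] in \<open>fastforce intro: order_trans\<close>)+
  have int_uy: "integrable (\<mu> 0) (\<lambda>p. (u p \<bullet> y) * w p)"
  proof (rule int_w[of _ "norm y"])
    fix p
    have "\<bar>u p \<bullet> y\<bar> \<le> norm (u p) * norm y" by (rule Cauchy_Schwarz_ineq2)
    also have "\<dots> \<le> (1 + (norm (u p))\<^sup>2) * norm y" by (intro mult_right_mono ru) auto
    finally show "\<bar>u p \<bullet> y\<bar> \<le> norm y * (1 + (norm (u p))\<^sup>2)" by (simp add: mult.commute)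
  qed (use um in measurable)
  have int_Ny: "integrable (\<mu> 0) (\<lambda>p. (N p \<bullet> y) * w p)"
  proof (rule int_w[of _ "norm y"])
    fix p assume p: "p \<in> topspace M"
    have "\<bar>N p \<bullet> y\<bar> \<le> norm y" using Cauchy_Schwarz_ineq2[of "N p" y] N1[OF p] by simp
    also have "\<dots> \<le> norm y * (1 + (norm (u p))\<^sup>2)" by (simp add: algebra_simps)
    finally show "\<bar>N p \<bullet> y\<bar> \<le> norm y * (1 + (norm (u p))\<^sup>2)" .
  qed (use Nm in measurable)

  obtain D B where D0: "\<And>p. p \<in> topspace M \<Longrightarrow> D 0 p = 1"
    and Dd: "\<And>p. p \<in> topspace M \<Longrightarrow> ((\<lambda>s. D s p) has_real_derivative - 2 * f p * H p) (at 0)"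
    and ev: "\<forall>\<^sub>F s in nhds 0. D s \<in> borel_measurable (\<mu> 0) \<and> \<mu> s = density (\<mu> 0) (\<lambda>p. ennreal (sqrt (D s p))) \<and>
       (\<forall>p\<in>topspace M. D s p > 0 \<and> \<bar>D s p - 1\<bar> \<le> B * \<bar>s\<bar> \<and> norm (X s p - X 0 p) \<le> B * \<bar>s\<bar>)"
    using relative_area_density[OF manifold hypersurface normal eps smooth_X normal_variation compact_support area]
    unfolding H_def by blast
  define L where "L = \<bar>B\<bar> + (norm y + 1) + (\<bar>h\<bar> + 1)"
  have L: "L > 0" unfolding L_def using norm_ge_zero[of y] by linarith
  obtain C \<delta> where C: "C > 0" "\<delta> > 0"
    and gauss: "\<And>\<sigma> \<rho> r t'. \<sigma> \<le> \<delta> \<Longrightarrow> \<rho> \<ge> 0 \<Longrightarrow> r \<ge> 0 \<Longrightarrow> \<bar>\<rho> - r\<bar> \<le> L * \<sigma> \<Longrightarrow> \<bar>t' - t 0\<bar> \<le> L * \<sigma> \<Longrightarrow>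
      \<bar>exp (- \<rho>\<^sup>2 / (2 * t')) - exp (- r\<^sup>2 / (2 * t 0))\<bar> \<le> C * \<sigma> * exp (- r\<^sup>2 / (2 * \<tau>))"
    using gaussian_lipschitz[OF t0 \<tau> L] by metis
  have evx: "\<forall>\<^sub>F s in nhds 0. norm (x s - x 0) \<le> (norm y + 1) * \<bar>s\<bar>"
    by (rule lipschitz_at_0_of_has_vector_derivative[OF deriv_x])
  have evt: "\<forall>\<^sub>F s in nhds 0. norm (t s - t 0) \<le> (norm h + 1) * \<bar>s\<bar>"
    by (rule lipschitz_at_0_of_has_vector_derivative)
       (use deriv_t in \<open>simp add: has_real_derivative_iff_has_vector_derivative\<close>)
  \<comment> \<open>The bound \<open>1 / L\<close> keeps \<open>L \<bar>s\<bar> \<le> 1\<close>, hence \<open>sqrt (D s p) \<le> 2\<close>.\<close>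
  define \<delta>' where "\<delta>' = min \<delta> (1 / L)"
  have "\<delta>' > 0" unfolding \<delta>'_def using C L by simp
  then have ev\<delta>: "\<forall>\<^sub>F s in nhds 0. s \<in> {-\<delta>'<..<\<delta>'}" by (intro eventually_nhds_in_open) auto
  define good where "good s \<longleftrightarrow> s \<in> ?I \<and> D s \<in> borel_measurable (\<mu> 0) \<and> \<mu> s = density (\<mu> 0) (\<lambda>p. ennreal (sqrt (D s p))) \<and>
     \<bar>s\<bar> \<le> \<delta>' \<and> \<bar>t s - t 0\<bar> \<le> L * \<bar>s\<bar> \<and> (\<forall>p\<in>topspace M. D s p > 0 \<and> \<bar>D s p - 1\<bar> \<le> L * \<bar>s\<bar> \<and>
     norm ((X s p - x s) - u p) \<le> L * \<bar>s\<bar>)" for s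
  have good: "\<forall>\<^sub>F s in nhds 0. good s"
    using I ev evx evt ev\<delta>
  proof eventually_elim
    case (elim s)
    have B: "B * \<bar>s\<bar> \<le> \<bar>B\<bar> * \<bar>s\<bar>" by (intro mult_right_mono) auto
    have "\<bar>B\<bar> * \<bar>s\<bar> + (norm y + 1) * \<bar>s\<bar> + (\<bar>h\<bar> + 1) * \<bar>s\<bar> = L * \<bar>s\<bar>" unfolding L_def by (simp add: algebra_simps)
    moreover have "0 \<le> \<bar>B\<bar> * \<bar>s\<bar>" "0 \<le> (norm y + 1) * \<bar>s\<bar>" "0 \<le> (\<bar>h\<bar> + 1) * \<bar>s\<bar>" by auto
    ultimately have L': "\<bar>B\<bar> * \<bar>s\<bar> + (norm y + 1) * \<bar>s\<bar> \<le> L * \<bar>s\<bar>" "\<bar>B\<bar> * \<bar>s\<bar> \<le> L * \<bar>s\<bar>" "(\<bar>h\<bar> + 1) * \<bar>s\<bar> \<le> L * \<bar>s\<bar>"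
      by linarith+
    have "norm ((X s p - x s) - u p) \<le> L * \<bar>s\<bar>" "\<bar>D s p - 1\<bar> \<le> L * \<bar>s\<bar>" if p: "p \<in> topspace M" for p
    proof -
      have "(X s p - x s) - u p = (X s p - X 0 p) - (x s - x 0)" by (simp add: u_def algebra_simps)
      then have "norm ((X s p - x s) - u p) \<le> norm (X s p - X 0 p) + norm (x s - x 0)"
        by (simp only: norm_triangle_ineq4)
      moreover have "norm (X s p - X 0 p) \<le> B * \<bar>s\<bar>" "\<bar>D s p - 1\<bar> \<le> B * \<bar>s\<bar>" using elim(2) p by blast+
      ultimately show "norm ((X s p - x s) - u p) \<le> L * \<bar>s\<bar>" "\<bar>D s p - 1\<bar> \<le> L * \<bar>s\<bar>"
        using B L' elim(3) by linarith+
    qed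
    moreover have "\<bar>t s - t 0\<bar> \<le> L * \<bar>s\<bar>" using elim(4) L'(3) by simp
    moreover have "\<bar>s\<bar> \<le> \<delta>'" using elim(5) by auto
    ultimately show ?case using elim(1,2) unfolding good_def by blast
  qed

  define \<Phi> where "\<Phi> s p = exp (- (norm (X s p - x s))\<^sup>2 / (2 * t s)) * sqrt (D s p)" for s p
  define \<Phi>' where "\<Phi>' p = w p * (- (u p \<bullet> (f p *\<^sub>R N p - y)) / t 0 + (norm (u p))\<^sup>2 * h / (2 * (t 0)\<^sup>2)) - f p * H p * w p" for p
  define \<Psi> where "\<Psi> s p = ((X s p - x s) \<bullet> N p) * w p" for s p
  define \<Psi>' where "\<Psi>' p = (f p - N p \<bullet> y) * w p" for p

  have gX: "X s \<in> borel_measurable (\<mu> 0)" and gD: "D s \<in> borel_measurable (\<mu> 0)" if "good s" for s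
    using that Xm unfolding good_def by blast+
  have \<Phi>0: "\<Phi> 0 p = w p" if "p \<in> topspace M" for p using D0[OF that] by (simp add: \<Phi>_def w_def)
  have \<Phi>m: "\<Phi> s \<in> borel_measurable (\<mu> 0)" if "good s" for s
    unfolding \<Phi>_def using gX[OF that] gD[OF that] by measurable
  have \<Phi>dom: "\<bar>\<Phi> s p - \<Phi> 0 p\<bar> \<le> \<bar>s - 0\<bar> * (2 * C * G p + L * w p)" if s: "good s" and p: "p \<in> topspace M" for s p
  proof -
    let ?e = "exp (- (norm (X s p - x s))\<^sup>2 / (2 * t s))" let ?q = "sqrt (D s p)"
    have e: "\<bar>?e - w p\<bar> \<le> C * \<bar>s\<bar> * G p"
      unfolding w_u G_def
    proof (rule gauss)
      show "\<bar>norm (X s p - x s) - norm (u p)\<bar> \<le> L * \<bar>s\<bar>"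
        using s p norm_triangle_ineq3[of "X s p - x s" "u p"] unfolding good_def by fastforce
    qed (use s in \<open>auto simp: good_def \<delta>'_def\<close>)
    have q: "\<bar>?q - 1\<bar> \<le> L * \<bar>s\<bar>" using s p sqrt_minus_one_le[of "D s p"] unfolding good_def by fastforce
    have "L * \<bar>s\<bar> \<le> 1" using s L unfolding good_def \<delta>'_def by (simp add: field_simps)
    then have q2: "\<bar>?q\<bar> \<le> 2" using q by linarith
    have "?e * ?q - w p = (?e - w p) * ?q + w p * (?q - 1)" by (simp add: algebra_simps)
    then have "\<bar>?e * ?q - w p\<bar> \<le> \<bar>?e - w p\<bar> * \<bar>?q\<bar> + w p * \<bar>?q - 1\<bar>"
      using abs_triangle_ineq[of "(?e - w p) * ?q" "w p * (?q - 1)"] w0[of p] by (simp add: abs_mult)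
    also have "\<dots> \<le> (C * \<bar>s\<bar> * G p) * 2 + w p * (L * \<bar>s\<bar>)"
      using e q q2 w0[of p] by (intro add_mono mult_mono) auto
    finally show ?thesis unfolding \<Phi>0[OF p] unfolding \<Phi>_def by (simp add: algebra_simps)
  qed
  have dX: "((\<lambda>s. X s p - x s) has_vector_derivative f p *\<^sub>R N p - y) (at 0)" if "p \<in> topspace M" for p
    by (intro has_vector_derivative_diff normal_variation[OF that] deriv_x)
  have \<Phi>d: "((\<lambda>s. \<Phi> s p) has_real_derivative \<Phi>' p) (at 0)" if p: "p \<in> topspace M" for p
  proof -
    let ?v = "f p *\<^sub>R N p - y"
    have "((\<lambda>s. (X s p - x s) \<bullet> (X s p - x s)) has_real_derivative 2 * (u p \<bullet> ?v)) (at 0)"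
      using has_derivative_inner[OF dX[OF p, unfolded has_vector_derivative_def] dX[OF p, unfolded has_vector_derivative_def]]
      unfolding has_field_derivative_def
      by (rule has_derivative_eq_rhs) (auto simp: fun_eq_iff u_def algebra_simps inner_commute)
    then have n: "((\<lambda>s. (norm (X s p - x s))\<^sup>2) has_real_derivative 2 * (u p \<bullet> ?v)) (at 0)"
      by (simp add: power2_norm_eq_inner)
    have "((\<lambda>s. - (norm (X s p - x s))\<^sup>2 / (2 * t s)) has_real_derivative
       - (u p \<bullet> ?v) / t 0 + (norm (u p))\<^sup>2 * h / (2 * (t 0)\<^sup>2)) (at 0)"
      by (rule DERIV_cong[OF DERIV_divide[OF DERIV_minus[OF n] DERIV_cmult[OF deriv_t, of 2]]])
         (use t0 in \<open>simp_all add: u_def field_simps power2_eq_square\<close>)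
    then have e: "((\<lambda>s. exp (- (norm (X s p - x s))\<^sup>2 / (2 * t s))) has_real_derivative
       w p * (- (u p \<bullet> ?v) / t 0 + (norm (u p))\<^sup>2 * h / (2 * (t 0)\<^sup>2))) (at 0)"
      unfolding w_def by (rule DERIV_fun_exp)
    have q: "((\<lambda>s. sqrt (D s p)) has_real_derivative - (f p * H p)) (at 0)"
      using D0[OF p] by (auto intro!: derivative_eq_intros Dd[OF p])
    show ?thesis unfolding \<Phi>_def
      using DERIV_mult[OF e q] D0[OF p] by (simp add: \<Phi>'_def w_def algebra_simps)
  qed
  have \<Psi>m: "\<Psi> s \<in> borel_measurable (\<mu> 0)" if "good s" for s
    unfolding \<Psi>_def using gX[OF that] Nm wm by measurable
  have \<Psi>0: "\<Psi> 0 = (\<lambda>p. (u p \<bullet> N p) * w p)" by (simp add: \<Psi>_def u_def fun_eq_iff)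
  have \<Psi>dom: "\<bar>\<Psi> s p - \<Psi> 0 p\<bar> \<le> \<bar>s - 0\<bar> * (L * w p)" if s: "good s" and p: "p \<in> topspace M" for s p
  proof -
    have "\<Psi> s p - \<Psi> 0 p = (((X s p - x s) - u p) \<bullet> N p) * w p"
      unfolding \<Psi>0 unfolding \<Psi>_def by (simp add: inner_diff_left algebra_simps)
    moreover have "\<bar>((X s p - x s) - u p) \<bullet> N p\<bar> \<le> L * \<bar>s\<bar>"
      using Cauchy_Schwarz_ineq2[of "(X s p - x s) - u p" "N p"] N1[OF p] s p unfolding good_def by fastforce
    ultimately show ?thesis using w0[of p] mult_right_mono[of _ "L * \<bar>s\<bar>" "w p"] by (simp add: abs_mult mult_ac)
  qed
  have \<Psi>d: "((\<lambda>s. \<Psi> s p) has_real_derivative \<Psi>' p) (at 0)" if p: "p \<in> topspace M" for p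
  proof -
    have "((\<lambda>s. (X s p - x s) \<bullet> N p) has_derivative (\<lambda>r. (r *\<^sub>R (f p *\<^sub>R N p - y)) \<bullet> N p)) (at 0)"
      using has_derivative_inner_left[OF dX[OF p, unfolded has_vector_derivative_def]] .
    then have "((\<lambda>s. (X s p - x s) \<bullet> N p) has_real_derivative f p - N p \<bullet> y) (at 0)"
      unfolding has_field_derivative_def
      by (rule has_derivative_eq_rhs)
         (use N1[OF p] in \<open>auto simp: fun_eq_iff algebra_simps inner_commute norm_eq_1\<close>)
    then show ?thesis unfolding \<Psi>_def \<Psi>'_def by (rule DERIV_cmult_right)
  qed
  have d\<Phi>: "integrable (\<mu> 0) \<Phi>'" "((\<lambda>s. \<integral>p. \<Phi> s p \<partial>\<mu> 0) has_real_derivative (\<integral>p. \<Phi>' p \<partial>\<mu> 0)) (at 0)"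
  proof -
    have "integrable (\<mu> 0) (\<Phi> 0)"
      by (rule Bochner_Integration.integrable_cong[THEN iffD1, OF refl _ int1]) (use \<Phi>0 ms(1) in auto)
    moreover have "\<forall>\<^sub>F s in nhds 0. \<Phi> s \<in> borel_measurable (\<mu> 0)" using good by eventually_elim (rule \<Phi>m)
    moreover have "integrable (\<mu> 0) (\<lambda>p. 2 * C * G p + L * w p)" using Gint int1 by simp
    moreover have "\<forall>\<^sub>F s in nhds 0. \<forall>p\<in>space (\<mu> 0). \<bar>\<Phi> s p - \<Phi> 0 p\<bar> \<le> \<bar>s - 0\<bar> * (2 * C * G p + L * w p)"
      using good by eventually_elim (use \<Phi>dom ms(1) in blast)
    ultimately show "integrable (\<mu> 0) \<Phi>'"
        "((\<lambda>s. \<integral>p. \<Phi> s p \<partial>\<mu> 0) has_real_derivative (\<integral>p. \<Phi>' p \<partial>\<mu> 0)) (at 0)"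
      using has_real_derivative_integral_at[where \<Phi> = \<Phi> and a = 0 and M = "\<mu> 0" and g = "\<lambda>p. 2 * C * G p + L * w p" and \<Phi>' = \<Phi>']
        \<Phi>d ms(1) by blast+
  qed
  have d\<Psi>: "integrable (\<mu> 0) \<Psi>'" "((\<lambda>s. \<integral>p. \<Psi> s p \<partial>\<mu> 0) has_real_derivative (\<integral>p. \<Psi>' p \<partial>\<mu> 0)) (at 0)"
  proof -
    have "integrable (\<mu> 0) (\<Psi> 0)" unfolding \<Psi>0 by (rule int_uN)
    moreover have "\<forall>\<^sub>F s in nhds 0. \<Psi> s \<in> borel_measurable (\<mu> 0)" using good by eventually_elim (rule \<Psi>m)
    moreover have "integrable (\<mu> 0) (\<lambda>p. L * w p)" using Gint int1 by simp
    moreover have "\<forall>\<^sub>F s in nhds 0. \<forall>p\<in>space (\<mu> 0). \<bar>\<Psi> s p - \<Psi> 0 p\<bar> \<le> \<bar>s - 0\<bar> * (L * w p)"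
      using good by eventually_elim (use \<Psi>dom ms(1) in blast)
    ultimately show "integrable (\<mu> 0) \<Psi>'"
        "((\<lambda>s. \<integral>p. \<Psi> s p \<partial>\<mu> 0) has_real_derivative (\<integral>p. \<Psi>' p \<partial>\<mu> 0)) (at 0)"
      using has_real_derivative_integral_at[where \<Phi> = \<Psi> and a = 0 and M = "\<mu> 0" and g = "\<lambda>p. L * w p" and \<Phi>' = \<Psi>']
        \<Psi>d ms(1) by blast+
  qed

  define K where "K = (4 * pi * t 0) powr (- real n / 2)"
  have F_eq: "\<forall>\<^sub>F s in nhds 0. F_functional n lam \<mu> X N x t s =
      (4 * pi * t s) powr (- real n / 2) * (\<integral>p. \<Phi> s p \<partial>\<mu> 0) + lam * K * sqrt (t 0 / t s) * (\<integral>p. \<Psi> s p \<partial>\<mu> 0)"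
    using good
  proof eventually_elim
    case (elim s)
    have "(\<integral>p. exp (- (norm (X s p - x s))\<^sup>2 / (2 * t s)) \<partial>\<mu> s)
      = (\<integral>p. exp (- (norm (X s p - x s))\<^sup>2 / (2 * t s)) \<partial>density (\<mu> 0) (\<lambda>p. ennreal (sqrt (D s p))))"
      using elim unfolding good_def by simp
    also have "\<dots> = (\<integral>p. sqrt (D s p) *\<^sub>R exp (- (norm (X s p - x s))\<^sup>2 / (2 * t s)) \<partial>\<mu> 0)"
    proof (rule integral_density)
      show "(\<lambda>p. exp (- (norm (X s p - x s))\<^sup>2 / (2 * t s))) \<in> borel_measurable (\<mu> 0)"
        using gX[OF elim] by measurable
      show "(\<lambda>p. sqrt (D s p)) \<in> borel_measurable (\<mu> 0)" using gD[OF elim] by measurable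
      show "AE p in \<mu> 0. 0 \<le> sqrt (D s p)" using elim ms(1) unfolding good_def by (intro AE_I2) (auto intro: less_imp_le)
    qed
    finally show ?case by (simp add: F_functional_def \<Phi>_def \<Psi>_def K_def w_def mult_ac)
  qed
  have dK: "((\<lambda>s. (4 * pi * t s) powr (- real n / 2)) has_real_derivative - (real n * h / (2 * t 0)) * K) (at 0)"
  proof -
    have d: "((\<lambda>s. (4 * pi * t s) powr (- real n / 2)) has_real_derivative
        (- real n / 2) * (4 * pi * t 0) powr (- real n / 2 - 1) * (4 * pi * h)) (at 0)"
      using t0 by (auto intro!: derivative_eq_intros deriv_t)
    have pw: "(4 * pi * t 0) powr (- real n / 2 - 1) = K / (4 * pi * t 0)"
      unfolding K_def using t0 by (simp add: powr_diff)
    show ?thesis by (rule DERIV_cong[OF d], unfold pw) (use t0 in simp)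
  qed
  have dS: "((\<lambda>s. sqrt (t 0 / t s)) has_real_derivative - (h / (2 * t 0))) (at 0)"
    using t0 by (auto intro!: derivative_eq_intros deriv_t simp: power2_eq_square)
  have "((\<lambda>s. (4 * pi * t s) powr (- real n / 2) * (\<integral>p. \<Phi> s p \<partial>\<mu> 0) + lam * K * sqrt (t 0 / t s) * (\<integral>p. \<Psi> s p \<partial>\<mu> 0))
      has_real_derivative - (real n * h / (2 * t 0)) * K * (\<integral>p. \<Phi> 0 p \<partial>\<mu> 0) + K * (\<integral>p. \<Phi>' p \<partial>\<mu> 0)
        + lam * K * (- (h / (2 * t 0)) * (\<integral>p. \<Psi> 0 p \<partial>\<mu> 0) + (\<integral>p. \<Psi>' p \<partial>\<mu> 0))) (at 0)"
    by (rule DERIV_cong[OF DERIV_add[OF DERIV_mult[OF dK d\<Phi>(2)] DERIV_mult[OF DERIV_cmult[OF dS, of "lam * K"] d\<Psi>(2)]]],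
        unfold K_def[symmetric]) (use t0 in \<open>simp add: field_simps\<close>)
  then have dF: "(F_functional n lam \<mu> X N x t has_real_derivative
      - (real n * h / (2 * t 0)) * K * (\<integral>p. \<Phi> 0 p \<partial>\<mu> 0) + K * (\<integral>p. \<Phi>' p \<partial>\<mu> 0)
        + lam * K * (- (h / (2 * t 0)) * (\<integral>p. \<Psi> 0 p \<partial>\<mu> 0) + (\<integral>p. \<Psi>' p \<partial>\<mu> 0))) (at 0)"
    by (subst DERIV_cong_ev[OF refl F_eq refl])

  \<comment> \<open>It remains to express both sides by the same integrals.\<close>
  let ?i0 = "\<integral>p. w p \<partial>\<mu> 0" let ?i2 = "\<integral>p. (norm (u p))\<^sup>2 * w p \<partial>\<mu> 0"
  let ?iuN = "\<integral>p. (u p \<bullet> N p) * w p \<partial>\<mu> 0" let ?iuy = "\<integral>p. (u p \<bullet> y) * w p \<partial>\<mu> 0"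
  let ?iNy = "\<integral>p. (N p \<bullet> y) * w p \<partial>\<mu> 0"
  have i\<Phi>0: "(\<integral>p. \<Phi> 0 p \<partial>\<mu> 0) = ?i0"
    using \<Phi>0 ms(1) by (intro Bochner_Integration.integral_cong) auto
  have i\<Psi>0: "(\<integral>p. \<Psi> 0 p \<partial>\<mu> 0) = ?iuN" unfolding \<Psi>0 ..
  have T1: "(\<integral>p. (lam - (H p + (u p /\<^sub>R t 0) \<bullet> N p)) * f p * w p \<partial>\<mu> 0)
     = (\<integral>p. \<Phi>' p \<partial>\<mu> 0) + lam * (\<integral>p. \<Psi>' p \<partial>\<mu> 0) + lam * ?iNy - (1 / t 0) * ?iuy - (h / (2 * (t 0)\<^sup>2)) * ?i2"
  proof -
    have "(\<integral>p. (lam - (H p + (u p /\<^sub>R t 0) \<bullet> N p)) * f p * w p \<partial>\<mu> 0) =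
      (\<integral>p. \<Phi>' p + lam * \<Psi>' p + lam * ((N p \<bullet> y) * w p) - (1 / t 0) * ((u p \<bullet> y) * w p)
         - (h / (2 * (t 0)\<^sup>2)) * ((norm (u p))\<^sup>2 * w p) \<partial>\<mu> 0)"
      by (intro Bochner_Integration.integral_cong refl)
         (use t0 in \<open>simp add: \<Phi>'_def \<Psi>'_def inner_diff_right field_simps power2_eq_square\<close>)
    then show ?thesis using d\<Phi>(1) d\<Psi>(1) int_Ny int_uy int_r2 by simp
  qed
  have T2: "(\<integral>p. ((u p /\<^sub>R t 0) \<bullet> y - lam * (N p \<bullet> y)) * w p \<partial>\<mu> 0) = (1 / t 0) * ?iuy - lam * ?iNy"
  proof -
    have "(\<integral>p. ((u p /\<^sub>R t 0) \<bullet> y - lam * (N p \<bullet> y)) * w p \<partial>\<mu> 0) =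
      (\<integral>p. (1 / t 0) * ((u p \<bullet> y) * w p) - lam * ((N p \<bullet> y) * w p) \<partial>\<mu> 0)"
      by (intro Bochner_Integration.integral_cong refl) (simp add: field_simps)
    then show ?thesis using int_Ny int_uy by simp
  qed
  have T3: "(\<integral>p. ((norm (u p))\<^sup>2 / t 0 - real n - lam * (u p \<bullet> N p)) * (h / (2 * t 0)) * w p \<partial>\<mu> 0)
     = (h / (2 * (t 0)\<^sup>2)) * ?i2 - (real n * h / (2 * t 0)) * ?i0 - (lam * h / (2 * t 0)) * ?iuN"
  proof -
    have "(\<integral>p. ((norm (u p))\<^sup>2 / t 0 - real n - lam * (u p \<bullet> N p)) * (h / (2 * t 0)) * w p \<partial>\<mu> 0) =
      (\<integral>p. (h / (2 * (t 0)\<^sup>2)) * ((norm (u p))\<^sup>2 * w p) - (real n * h / (2 * t 0)) * w p - (lam * h / (2 * t 0)) * ((u p \<bullet> N p) * w p) \<partial>\<mu> 0)"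
      by (intro Bochner_Integration.integral_cong refl) (use t0 in \<open>simp add: field_simps power2_eq_square\<close>)
    then show ?thesis using int_r2 int1 int_uN by simp
  qed
  have "(F_functional n lam \<mu> X N x t has_real_derivative
      K * (\<integral>p. (lam - (H p + (u p /\<^sub>R t 0) \<bullet> N p)) * f p * w p \<partial>\<mu> 0)
    + K * (\<integral>p. ((u p /\<^sub>R t 0) \<bullet> y - lam * (N p \<bullet> y)) * w p \<partial>\<mu> 0)
    + K * (\<integral>p. ((norm (u p))\<^sup>2 / t 0 - real n - lam * (u p \<bullet> N p)) * (h / (2 * t 0)) * w p \<partial>\<mu> 0)) (at 0)"
    using dF unfolding T1 T2 T3 i\<Phi>0 i\<Psi>0 by (rule DERIV_cong) (simp add: algebra_simps)
  then show ?thesis unfolding K_def u_def .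
qed

end
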